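(* If a primitive harmonic map $\varphi:\mathbb{R}^2\to G/K$ into a $k$-symmetric space is $\mathbb{R}$-equivariant, then so are all members of its associated family: for every $\lambda\in S^1$ the primitive harmonic map $\varphi_\lambda=F_\lambda K:\mathbb R^2\to G/K$ is $\mathbb R$-equivariant.
   Context: $G$ is a compact semisimple Lie group with Lie algebra $\mathfrak g$; $\tau:G\to G$ is an automorphism of finite order $k\ge2$ and $(G^\tau)_0\subset K\subset G^\tau$. With $\omega=e^{2\pi i/k}$, $\mathfrak g_\ell\subset\mathfrak g^{\mathbb C}$ is the $\omega^\ell$-eigenspace of $\tau$ ($\ell\in\mathbb Z_k$), $\mathfrak k$ is the Lie algebra of $K$, and $\mathfrak m\subset\mathfrak g$ is defined by $\mathfrak m^{\mathbb C}=\sum_{\ell\neq0}\mathfrak g_\ell$, so $\mathfrak g=\mathfrak k\oplus\mathfrak m$. All maps are smooth and $z=x+iy$ on $\mathbb R^2=\mathbb C$. A frame of $\varphi:\mathbb R^2\to G/K$ is a map $F:\mathbb R^2\to G$ with $\varphi=FK$. Put $\alpha=F^{-1}dF=\alpha_{\mathfrak k}+\alpha_{\mathfrak m}$, and $\alpha_{\mathfrak m}=\alpha'_{\mathfrak m}+\alpha''_{\mathfrak m}$ its decomposition into $(1,0)$- and $(0,1)$-parts. $\varphi$ is harmonic if $d\alpha_{\mathfrak m}'+[\alpha_{\mathfrak k}\wedge\alpha_{\mathfrak m}']=0$, primitive if $\alpha'_{\mathfrak m}$ takes values in $\mathfrak g_{-1}$, and primitive harmonic if $k=2$ and it is harmonic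 or $k>2$ and it is primitive. $\varphi$ is $\mathbb R$-equivariant if $\varphi(x,y)=\exp(xA_0)\psi(y)$ for some $A_0\in\mathfrak g$ and map $\psi:\mathbb R\to G/K$. If $F$ frames a primitive harmonic map, then $\alpha_\lambda=\alpha_{\mathfrak k}+\lambda^{-1}\alpha_{\mathfrak m}'+\lambda\alpha_{\mathfrak m}''$ satisfies the Maurer–Cartan equation for every $\lambda\in\mathbb C^\times$, and one can integrate $F_\lambda^{-1}dF_\lambda=\alpha_\lambda$ with constants of integration chosen so that $F_1=F$, $F_\lambda$ takes values in $G$ for $\lambda\in S^1$, and $\tau F_\lambda=F_{\omega\lambda}$ ($F_\lambda$ is called an extended frame). For each $\lambda\in S^1$, $F_\lambda$ frames a primitive harmonic map $\varphi_\lambda=F_\lambda K$; the maps $\varphi_\lambda$, $\lambda\in S^1$, are the associated family of $\varphi$. *)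

theory Defs
  imports "HOL-Analysis.Analysis" "HOL-Algebra.Coset"
begin

section \<open>Smooth maps between open subsets of Euclidean spaces\<close>

text \<open>For open \<open>S\<close> and finite-dimensional domain, \<open>Ck_on n S f\<close> says that \<open>f\<close> is of class
  \<open>C^n\<close> on \<open>S\<close>.\<close>

primrec Ck_on :: "nat \<Rightarrow> 'a::euclidean_space set \<Rightarrow> ('a \<Rightarrow> 'b::euclidean_space) \<Rightarrow> bool" where
  "Ck_on 0 S f \<longleftrightarrow> continuous_on S f"
| "Ck_on (Suc n) S f \<longleftrightarrow>
     (\<forall>x\<in>S. f differentiable (at x)) \<and> (\<forall>v. Ck_on n S (\<lambda>x. frechet_derivative f (at x) v))"

definition smooth_fun_on :: "'a::euclidean_space set \<Rightarrow> ('a \<Rightarrow> 'b::euclidean_space) \<Rightarrow> bool" where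
  "smooth_fun_on S f \<longleftrightarrow> (\<forall>n. Ck_on n S f)"


section \<open>Smooth manifolds and Lie groups\<close>

text \<open>A chart is a pair \<open>(U, h)\<close> of a coordinate domain and a coordinate map; the model space
  is a Euclidean space \<open>'e\<close>, so \<open>DIM('e)\<close> is the dimension of the manifold.
  Only the restriction of \<open>h\<close> to \<open>U\<close> matters.\<close>

type_synonym ('g, 'e) chart = "'g set \<times> ('g \<Rightarrow> 'e)"

definition chart_inv :: "('g, 'e) chart \<Rightarrow> 'e \<Rightarrow> 'g" where
  "chart_inv c = inv_into (fst c) (snd c)"

definition chart_image :: "('g, 'e) chart \<Rightarrow> 'e set" where
  "chart_image c = snd c ` fst c"

definition smooth_manifold :: "'g topology \<Rightarrow> ('g, 'e::euclidean_space) chart set \<Rightarrow> bool" where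
  "smooth_manifold T A \<longleftrightarrow>
     Hausdorff_space T \<and> second_countable T \<and>
     topspace T = (\<Union>c\<in>A. fst c) \<and>
     (\<forall>c\<in>A. openin T (fst c) \<and> open (chart_image c) \<and>
        homeomorphic_map (subtopology T (fst c)) (top_of_set (chart_image c)) (snd c)) \<and>
     (\<forall>c\<in>A. \<forall>d\<in>A. smooth_fun_on (snd c ` (fst c \<inter> fst d)) (snd d \<circ> chart_inv c))"

record ('g, 'e) lie_group_data = "'g monoid" +
  topo :: "'g topology"
  atlas :: "('g, 'e) chart set"

text \<open>Smoothness of a map from an open subset \<open>D\<close> of a Euclidean space to the manifold
  underlying \<open>G\<close>.\<close>

definition smooth_into ::
    "('g, 'e::euclidean_space) lie_group_data \<Rightarrow> 'd::euclidean_space set \<Rightarrow> ('d \<Rightarrow> 'g) \<Rightarrow> bool" where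
  "smooth_into G D f \<longleftrightarrow>
     (\<forall>p\<in>D. \<exists>c\<in>atlas G. \<exists>N. open N \<and> p \<in> N \<and> N \<subseteq> D \<and> f ` N \<subseteq> fst c \<and>
        smooth_fun_on N (snd c \<circ> f))"

definition smooth_self_map ::
    "('g, 'e::euclidean_space) lie_group_data \<Rightarrow> ('g \<Rightarrow> 'g) \<Rightarrow> bool" where
  "smooth_self_map G f \<longleftrightarrow> (\<forall>c\<in>atlas G. smooth_into G (chart_image c) (f \<circ> chart_inv c))"

definition lie_group :: "('g, 'e::euclidean_space) lie_group_data \<Rightarrow> bool" where
  "lie_group G \<longleftrightarrow>
     group G \<and> topspace (topo G) = carrier G \<and> smooth_manifold (topo G) (atlas G) \<and>
     (\<forall>c\<in>atlas G. \<forall>d\<in>atlas G. smooth_into G (chart_image c \<times> chart_image d)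
        (\<lambda>(u, v). chart_inv c u \<otimes>\<^bsub>G\<^esub> chart_inv d v)) \<and>
     smooth_self_map G (\<lambda>g. inv\<^bsub>G\<^esub> g)"


section \<open>The Lie algebra and the exponential map\<close>

text \<open>A tangent vector at the identity is determined by its coordinates in any one chart
  around the identity.  Fixing such a chart identifies the Lie algebra of \<open>G\<close> with the whole
  space \<open>'e\<close>; a different choice changes everything below by a linear isomorphism.\<close>

definition chart_one :: "('g, 'e::euclidean_space) lie_group_data \<Rightarrow> ('g, 'e) chart" where
  "chart_one G = (SOME c. c \<in> atlas G \<and> \<one>\<^bsub>G\<^esub> \<in> fst c)"

definition coord_one :: "('g, 'e::euclidean_space) lie_group_data \<Rightarrow> 'e" where
  "coord_one G = snd (chart_one G) \<one>\<^bsub>G\<^esub>"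

text \<open>Velocity at \<open>0\<close> of a curve in \<open>G\<close> that is at the identity at time \<open>0\<close>.\<close>

definition velocity :: "('g, 'e::euclidean_space) lie_group_data \<Rightarrow> (real \<Rightarrow> 'g) \<Rightarrow> 'e" where
  "velocity G \<gamma> = vector_derivative (\<lambda>s. snd (chart_one G) (\<gamma> s)) (at 0)"

text \<open>Differential at the identity of a map \<open>f\<close> fixing the identity.\<close>

definition diff_one ::
    "('g, 'e::euclidean_space) lie_group_data \<Rightarrow> ('g \<Rightarrow> 'g) \<Rightarrow> 'e \<Rightarrow> 'e" where
  "diff_one G f =
     frechet_derivative (snd (chart_one G) \<circ> f \<circ> chart_inv (chart_one G)) (at (coord_one G))"

definition Ad :: "('g, 'e::euclidean_space) lie_group_data \<Rightarrow> 'g \<Rightarrow> 'e \<Rightarrow> 'e" where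
  "Ad G g = diff_one G (\<lambda>x. g \<otimes>\<^bsub>G\<^esub> x \<otimes>\<^bsub>G\<^esub> inv\<^bsub>G\<^esub> g)"

text \<open>\<open>[X, Y] = ad X Y\<close>, where \<open>ad\<close> is the differential of \<open>Ad\<close> at the identity.\<close>

definition bracket :: "('g, 'e::euclidean_space) lie_group_data \<Rightarrow> 'e \<Rightarrow> 'e \<Rightarrow> 'e" where
  "bracket G X Y =
     frechet_derivative (\<lambda>u. Ad G (chart_inv (chart_one G) u) Y) (at (coord_one G)) X"

definition one_param_subgroup ::
    "('g, 'e::euclidean_space) lie_group_data \<Rightarrow> (real \<Rightarrow> 'g) \<Rightarrow> bool" where
  "one_param_subgroup G \<gamma> \<longleftrightarrow>
     smooth_into G UNIV \<gamma> \<and> (\<forall>s t. \<gamma> (s + t) = \<gamma> s \<otimes>\<^bsub>G\<^esub> \<gamma> t)"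

definition lie_exp :: "('g, 'e::euclidean_space) lie_group_data \<Rightarrow> 'e \<Rightarrow> 'g" where
  "lie_exp G X = (THE \<gamma>. one_param_subgroup G \<gamma> \<and> velocity G \<gamma> = X) 1"

definition lie_ideal :: "('g, 'e::euclidean_space) lie_group_data \<Rightarrow> 'e set \<Rightarrow> bool" where
  "lie_ideal G I \<longleftrightarrow> subspace I \<and> (\<forall>X. \<forall>Y\<in>I. bracket G X Y \<in> I)"

definition derived_alg :: "('g, 'e::euclidean_space) lie_group_data \<Rightarrow> 'e set \<Rightarrow> 'e set" where
  "derived_alg G I = span {bracket G X Y | X Y. X \<in> I \<and> Y \<in> I}"

definition solvable_alg :: "('g, 'e::euclidean_space) lie_group_data \<Rightarrow> 'e set \<Rightarrow> bool" where
  "solvable_alg G I \<longleftrightarrow> (\<exists>n. (derived_alg G ^^ n) I = {0})"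

definition compact_semisimple_lie_group :: "('g, 'e::euclidean_space) lie_group_data \<Rightarrow> bool" where
  "compact_semisimple_lie_group G \<longleftrightarrow>
     lie_group G \<and> compact_space (topo G) \<and>
     (\<forall>I. lie_ideal G I \<and> solvable_alg G I \<longrightarrow> I = {0})"


section \<open>The complexified Lie algebra\<close>

text \<open>The pair \<open>(X, Y)\<close> stands for \<open>X + iY\<close>.\<close>

type_synonym 'e cplx = "'e \<times> 'e"

definition cscale :: "complex \<Rightarrow> 'e::euclidean_space cplx \<Rightarrow> 'e cplx" where
  "cscale c Z = (Re c *\<^sub>R fst Z - Im c *\<^sub>R snd Z, Re c *\<^sub>R snd Z + Im c *\<^sub>R fst Z)"

definition cembed :: "'e::euclidean_space \<Rightarrow> 'e cplx" where
  "cembed X = (X, 0)"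

definition cextend :: "('e::euclidean_space \<Rightarrow> 'e) \<Rightarrow> 'e cplx \<Rightarrow> 'e cplx" where
  "cextend f Z = (f (fst Z), f (snd Z))"

definition cbracket ::
    "('g, 'e::euclidean_space) lie_group_data \<Rightarrow> 'e cplx \<Rightarrow> 'e cplx \<Rightarrow> 'e cplx" where
  "cbracket G Z W =
     (bracket G (fst Z) (fst W) - bracket G (snd Z) (snd W),
      bracket G (fst Z) (snd W) + bracket G (snd Z) (fst W))"


section \<open>\<open>k\<close>-symmetric spaces\<close>

definition fixed_group :: "('g, 'e::euclidean_space) lie_group_data \<Rightarrow> ('g \<Rightarrow> 'g) \<Rightarrow> 'g set" where
  "fixed_group G \<tau> = {g \<in> carrier G. \<tau> g = g}"

definition k_symmetric ::
    "('g, 'e::euclidean_space) lie_group_data \<Rightarrow> ('g \<Rightarrow> 'g) \<Rightarrow> 'g set \<Rightarrow> nat \<Rightarrow> bool" where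
  "k_symmetric G \<tau> K k \<longleftrightarrow>
     \<tau> \<in> iso G G \<and> smooth_self_map G \<tau> \<and>
     k \<ge> 2 \<and> (\<forall>g\<in>carrier G. (\<tau> ^^ k) g = g) \<and>
     (\<forall>j. 0 < j \<and> j < k \<longrightarrow> (\<exists>g\<in>carrier G. (\<tau> ^^ j) g \<noteq> g)) \<and>
     subgroup K G \<and>
     connected_component_of_set (subtopology (topo G) (fixed_group G \<tau>)) \<one>\<^bsub>G\<^esub> \<subseteq> K \<and>
     K \<subseteq> fixed_group G \<tau>"

definition root_of_one :: "nat \<Rightarrow> complex" where
  "root_of_one k = exp (2 * of_real pi * \<i> / of_nat k)"

definition eigenspace ::
    "('g, 'e::euclidean_space) lie_group_data \<Rightarrow> ('g \<Rightarrow> 'g) \<Rightarrow> nat \<Rightarrow> int \<Rightarrow> 'e cplx set" where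
  "eigenspace G \<tau> k l =
     {Z. cextend (diff_one G \<tau>) Z = cscale (root_of_one k powi l) Z}"

text \<open>The Lie algebra of the (closed) subgroup \<open>K\<close>.\<close>

definition k_alg :: "('g, 'e::euclidean_space) lie_group_data \<Rightarrow> 'g set \<Rightarrow> 'e set" where
  "k_alg G K = {X. \<forall>t::real. lie_exp G (t *\<^sub>R X) \<in> K}"

definition m_space ::
    "('g, 'e::euclidean_space) lie_group_data \<Rightarrow> ('g \<Rightarrow> 'g) \<Rightarrow> nat \<Rightarrow> 'e set" where
  "m_space G \<tau> k =
     {X. \<exists>Z. (\<forall>l\<in>{1..<k}. Z l \<in> eigenspace G \<tau> k (int l)) \<and> cembed X = (\<Sum>l\<in>{1..<k}. Z l)}"

text \<open>Components with respect to the direct sum of \<open>k_alg G K\<close> and \<open>m_space G \<tau> k\<close>.\<close>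

definition m_part ::
    "('g, 'e::euclidean_space) lie_group_data \<Rightarrow> ('g \<Rightarrow> 'g) \<Rightarrow> 'g set \<Rightarrow> nat \<Rightarrow> 'e \<Rightarrow> 'e" where
  "m_part G \<tau> K k X = (THE Y. Y \<in> m_space G \<tau> k \<and> X - Y \<in> k_alg G K)"

definition k_part ::
    "('g, 'e::euclidean_space) lie_group_data \<Rightarrow> ('g \<Rightarrow> 'g) \<Rightarrow> 'g set \<Rightarrow> nat \<Rightarrow> 'e \<Rightarrow> 'e" where
  "k_part G \<tau> K k X = (THE Y. Y \<in> k_alg G K \<and> X - Y \<in> m_space G \<tau> k)"

text \<open>A point of \<open>G/K\<close> is a left coset, as a subset of \<open>carrier G\<close>.  As \<open>G \<rightarrow> G/K\<close> is a
  surjective submersion, a map into \<open>G/K\<close> is smooth iff it lifts locally to smooth maps into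
  \<open>G\<close>.\<close>

definition smooth_into_quotient ::
    "('g, 'e::euclidean_space) lie_group_data \<Rightarrow> 'g set \<Rightarrow> ('d::euclidean_space \<Rightarrow> 'g set) \<Rightarrow> bool" where
  "smooth_into_quotient G K f \<longleftrightarrow>
     (\<forall>p. \<exists>N g. open N \<and> p \<in> N \<and> smooth_into G N g \<and> (\<forall>q\<in>N. f q = g q <#\<^bsub>G\<^esub> K))"


section \<open>Frames and differential forms on the plane\<close>

text \<open>The plane is the type \<^typ>\<open>complex\<close>.  A vector-valued one-form \<open>\<beta>\<close> on it is a
  function of a point \<open>p\<close> and a tangent vector \<open>v\<close>, a two-form a function of a point and two
  tangent vectors.\<close>

definition frame ::
    "('g, 'e::euclidean_space) lie_group_data \<Rightarrow> 'g set \<Rightarrow> (complex \<Rightarrow> 'g set) \<Rightarrow>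
      (complex \<Rightarrow> 'g) \<Rightarrow> bool" where
  "frame G K \<phi> F \<longleftrightarrow> smooth_into G UNIV F \<and> (\<forall>p. \<phi> p = F p <#\<^bsub>G\<^esub> K)"

text \<open>The form \<open>F\<inverse> dF\<close>.\<close>

definition mc_form ::
    "('g, 'e::euclidean_space) lie_group_data \<Rightarrow> (complex \<Rightarrow> 'g) \<Rightarrow> complex \<Rightarrow> complex \<Rightarrow> 'e" where
  "mc_form G F p v = velocity G (\<lambda>s. inv\<^bsub>G\<^esub> (F p) \<otimes>\<^bsub>G\<^esub> F (p + s *\<^sub>R v))"

definition form_10 ::
    "(complex \<Rightarrow> complex \<Rightarrow> 'e::euclidean_space cplx) \<Rightarrow> complex \<Rightarrow> complex \<Rightarrow> 'e cplx" where
  "form_10 \<beta> p v = (1/2) *\<^sub>R (\<beta> p v - cscale \<i> (\<beta> p (\<i> * v)))"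

definition form_01 ::
    "(complex \<Rightarrow> complex \<Rightarrow> 'e::euclidean_space cplx) \<Rightarrow> complex \<Rightarrow> complex \<Rightarrow> 'e cplx" where
  "form_01 \<beta> p v = (1/2) *\<^sub>R (\<beta> p v + cscale \<i> (\<beta> p (\<i> * v)))"

definition ext_deriv ::
    "(complex \<Rightarrow> complex \<Rightarrow> 'e::euclidean_space cplx) \<Rightarrow>
      complex \<Rightarrow> complex \<Rightarrow> complex \<Rightarrow> 'e cplx" where
  "ext_deriv \<beta> p u v =
     frechet_derivative (\<lambda>q. \<beta> q v) (at p) u - frechet_derivative (\<lambda>q. \<beta> q u) (at p) v"

definition wedge_bracket ::
    "('g, 'e::euclidean_space) lie_group_data \<Rightarrow>
      (complex \<Rightarrow> complex \<Rightarrow> 'e cplx) \<Rightarrow> (complex \<Rightarrow> complex \<Rightarrow> 'e cplx) \<Rightarrow>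
      complex \<Rightarrow> complex \<Rightarrow> complex \<Rightarrow> 'e cplx" where
  "wedge_bracket G \<beta> \<gamma> p u v = cbracket G (\<beta> p u) (\<gamma> p v) - cbracket G (\<beta> p v) (\<gamma> p u)"

definition alpha_k ::
    "('g, 'e::euclidean_space) lie_group_data \<Rightarrow> ('g \<Rightarrow> 'g) \<Rightarrow> 'g set \<Rightarrow> nat \<Rightarrow>
      (complex \<Rightarrow> 'g) \<Rightarrow> complex \<Rightarrow> complex \<Rightarrow> 'e cplx" where
  "alpha_k G \<tau> K k F p v = cembed (k_part G \<tau> K k (mc_form G F p v))"

definition alpha_m ::
    "('g, 'e::euclidean_space) lie_group_data \<Rightarrow> ('g \<Rightarrow> 'g) \<Rightarrow> 'g set \<Rightarrow> nat \<Rightarrow>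
      (complex \<Rightarrow> 'g) \<Rightarrow> complex \<Rightarrow> complex \<Rightarrow> 'e cplx" where
  "alpha_m G \<tau> K k F p v = cembed (m_part G \<tau> K k (mc_form G F p v))"


section \<open>Primitive harmonic maps, extended frames, equivariance\<close>

text \<open>Every smooth map from the plane to \<open>G/K\<close> has a frame, and the conditions on a frame in the
  next two definitions do not depend on which frame of the map is used.\<close>

definition harmonic_map ::
    "('g, 'e::euclidean_space) lie_group_data \<Rightarrow> ('g \<Rightarrow> 'g) \<Rightarrow> 'g set \<Rightarrow> nat \<Rightarrow>
      (complex \<Rightarrow> 'g set) \<Rightarrow> bool" where
  "harmonic_map G \<tau> K k \<phi> \<longleftrightarrow>
     (\<exists>F. frame G K \<phi> F \<and>
       (\<forall>p u v. ext_deriv (form_10 (alpha_m G \<tau> K k F)) p u v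
          + wedge_bracket G (alpha_k G \<tau> K k F) (form_10 (alpha_m G \<tau> K k F)) p u v = 0))"

definition primitive_map ::
    "('g, 'e::euclidean_space) lie_group_data \<Rightarrow> ('g \<Rightarrow> 'g) \<Rightarrow> 'g set \<Rightarrow> nat \<Rightarrow>
      (complex \<Rightarrow> 'g set) \<Rightarrow> bool" where
  "primitive_map G \<tau> K k \<phi> \<longleftrightarrow>
     (\<exists>F. frame G K \<phi> F \<and>
       (\<forall>p v. form_10 (alpha_m G \<tau> K k F) p v \<in> eigenspace G \<tau> k (-1)))"

definition primitive_harmonic ::
    "('g, 'e::euclidean_space) lie_group_data \<Rightarrow> ('g \<Rightarrow> 'g) \<Rightarrow> 'g set \<Rightarrow> nat \<Rightarrow>
      (complex \<Rightarrow> 'g set) \<Rightarrow> bool" where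
  "primitive_harmonic G \<tau> K k \<phi> \<longleftrightarrow>
     (k = 2 \<and> harmonic_map G \<tau> K k \<phi>) \<or> (k > 2 \<and> primitive_map G \<tau> K k \<phi>)"

definition alpha_lambda ::
    "('g, 'e::euclidean_space) lie_group_data \<Rightarrow> ('g \<Rightarrow> 'g) \<Rightarrow> 'g set \<Rightarrow> nat \<Rightarrow>
      (complex \<Rightarrow> 'g) \<Rightarrow> complex \<Rightarrow> complex \<Rightarrow> complex \<Rightarrow> 'e cplx" where
  "alpha_lambda G \<tau> K k F \<zeta> p v =
     alpha_k G \<tau> K k F p v
     + cscale (inverse \<zeta>) (form_10 (alpha_m G \<tau> K k F) p v)
     + cscale \<zeta> (form_01 (alpha_m G \<tau> K k F) p v)"

text \<open>Extended frames are families over the unit circle, where they take values in \<open>G\<close> itself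
  and not just in its complexification.  The values of \<open>E\<close> off the circle are irrelevant.\<close>

definition extended_frame ::
    "('g, 'e::euclidean_space) lie_group_data \<Rightarrow> ('g \<Rightarrow> 'g) \<Rightarrow> 'g set \<Rightarrow> nat \<Rightarrow>
      (complex \<Rightarrow> 'g) \<Rightarrow> (complex \<Rightarrow> complex \<Rightarrow> 'g) \<Rightarrow> bool" where
  "extended_frame G \<tau> K k F E \<longleftrightarrow>
     E 1 = F \<and>
     (\<forall>\<zeta>. cmod \<zeta> = 1 \<longrightarrow>
        smooth_into G UNIV (E \<zeta>) \<and>
        (\<forall>p v. cembed (mc_form G (E \<zeta>) p v) = alpha_lambda G \<tau> K k F \<zeta> p v) \<and>
        (\<forall>p. \<tau> (E \<zeta> p) = E (root_of_one k * \<zeta>) p))"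

definition R_equivariant ::
    "('g, 'e::euclidean_space) lie_group_data \<Rightarrow> 'g set \<Rightarrow> (complex \<Rightarrow> 'g set) \<Rightarrow> bool" where
  "R_equivariant G K \<phi> \<longleftrightarrow>
     (\<exists>A\<^sub>0. \<exists>\<psi> :: real \<Rightarrow> 'g set. smooth_into_quotient G K \<psi> \<and>
        (\<forall>x y. \<phi> (Complex x y) = lie_exp G (x *\<^sub>R A\<^sub>0) <#\<^bsub>G\<^esub> \<psi> y))"

end

theory Submission
  imports Defs
begin

text \<open>
  Write \<open>\<phi> (x, y) = exp (x A\<^sub>0) \<psi> y\<close>. Then \<open>F' (x, y) = exp (x A\<^sub>0) F (0, y)\<close> is a second frame of
  \<open>\<phi>\<close>, so that \<open>F = F' h\<close> with \<open>h\<close> smooth and \<open>K\<close>-valued (\<open>equivariant_frame\<close>). The frame \<open>F'\<close> has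
  a logarithmic derivative which does not depend on \<open>x\<close>, and neither does, therefore, any form
  \<open>\<alpha>\<^sub>\<lambda>\<close> built from it. On the other hand the gauge transformation \<open>h\<close> acts on all the \<open>\<alpha>\<^sub>\<lambda>\<close> by the
  usual formula (\<open>alpha_lambda_gauge\<close>), because \<open>Ad (h\<inverse>)\<close> respects the reductive decomposition and
  \<open>h\<inverse> dh\<close> has values in the Lie algebra of \<open>K\<close>. Hence \<open>E' = E\<^sub>\<lambda> h\<inverse>\<close>, which frames the
  same map as \<open>E\<^sub>\<lambda>\<close>, integrates the \<open>x\<close>-independent form \<open>\<alpha>\<^sub>\<lambda>\<close> of \<open>F'\<close>
  (\<open>darboux_gauged_frame\<close>). As maps with the same logarithmic derivative differ by a constant left
  factor, \<open>E' (x + t, y) = c t E' (x, y)\<close>; this forces \<open>c\<close> to be a homomorphism, so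
  \<open>c t = exp (t B)\<close> for some \<open>B\<close> (\<open>invariant_darboux_imp_equivariant\<close>).

  The argument rests on elementary Lie theory, developed from charts. The product rule for
  logarithmic derivatives and the uniqueness statement just used (\<open>darboux_mult\<close>,
  \<open>darboux_eq_imp_left_translate\<close>) come from the fact that the multiplication has derivative
  \<open>(X, Y) \<mapsto> X + Y\<close> at the identity. One-parameter subgroups with prescribed velocity exist
  (\<open>one_param_exists\<close>): left-invariant vector fields have local integral curves by the
  Picard--Lindeloef theorem, and these extend by repeated doubling. Existence is also what identifies
  the Lie algebra of \<open>K\<close> with the fixed space of the differential \<open>T\<close> of \<open>\<tau>\<close> (\<open>k_alg_eq\<close>). Since
  \<open>T\<close> has finite order, the complement \<open>m_space G \<tau> k\<close> is the kernel of
  \<open>1 + T + \<dots> + T\<^sup>k\<^sup>-\<^sup>1\<close> (\<open>m_space_eq\<close>), which makes the two projections explicit.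
\<close>

section \<open>Calculus of smooth maps between Euclidean spaces\<close>

lemma Ck_on_cong:
  assumes "open S" and "\<And>x. x \<in> S \<Longrightarrow> f x = g x" and "Ck_on n S f"
  shows "Ck_on n S g"
  using assms(2,3)
proof (induction n arbitrary: f g)
  case 0
  have "continuous_on S g \<longleftrightarrow> continuous_on S f"
    by (rule continuous_on_cong) (simp_all add: 0)
  then show ?case using 0 by simp
next
  case (Suc n)
  have d: "(g has_derivative frechet_derivative f (at x)) (at x)" if "x \<in> S" for x
    by (rule has_derivative_transform_within_open[OF _ \<open>open S\<close> that Suc.prems(1)])
      (use Suc.prems(2) that in \<open>simp add: frechet_derivative_works\<close>)
  have "Ck_on n S (\<lambda>x. frechet_derivative g (at x) v)" for v
    by (rule Suc.IH[of "\<lambda>x. frechet_derivative f (at x) v"])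
      (use Suc.prems(2) in \<open>simp_all add: frechet_derivative_at[OF d]\<close>)
  moreover have "g differentiable (at x)" if "x \<in> S" for x
    using d[OF that] by (rule differentiableI)
  ultimately show ?case by simp
qed

lemma Ck_on_subset: "Ck_on n S f \<Longrightarrow> T \<subseteq> S \<Longrightarrow> Ck_on n T f"
proof (induction n arbitrary: f)
  case 0
  then show ?case using continuous_on_subset by simp
next
  case (Suc n)
  then show ?case by (simp add: subset_iff)
qed

lemma Ck_on_SucD: "Ck_on (Suc n) S f \<Longrightarrow> Ck_on n S f"
proof (induction n arbitrary: f)
  case 0
  then have "f differentiable (at x)" if "x \<in> S" for x using that by simp
  then show ?case
    by (simp add: continuous_at_imp_continuous_on differentiable_imp_continuous_within)
next
  case (Suc n)
  have "Ck_on n S (\<lambda>x. frechet_derivative f (at x) v)" for v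
    by (rule Suc.IH) (use Suc.prems in simp)
  then show ?case using Suc.prems by simp
qed

lemma Ck_on_SucI:
  assumes "open S" and d: "\<And>x. x \<in> S \<Longrightarrow> (f has_derivative D x) (at x)"
    and D: "\<And>v. Ck_on n S (\<lambda>x. D x v)"
  shows "Ck_on (Suc n) S f"
proof -
  have "Ck_on n S (\<lambda>x. frechet_derivative f (at x) v)" for v
    by (rule Ck_on_cong[OF \<open>open S\<close> _ D[of v]]) (simp add: frechet_derivative_at[OF d, symmetric])
  moreover have "f differentiable (at x)" if "x \<in> S" for x
    using d[OF that] by (rule differentiableI)
  ultimately show ?thesis by simp
qed

lemma Ck_on_SucD_derivative:
  "Ck_on (Suc n) S f \<Longrightarrow> x \<in> S \<Longrightarrow> (f has_derivative frechet_derivative f (at x)) (at x)"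
  by (simp add: frechet_derivative_works)

lemma Ck_on_const: "Ck_on n S (\<lambda>x. c)"
  by (induction n arbitrary: c) simp_all

lemma Ck_on_bounded_linear_comp:
  assumes "bounded_linear L" and "open S" and "Ck_on n S f"
  shows "Ck_on n S (\<lambda>x. L (f x))"
  using assms(3)
proof (induction n arbitrary: f)
  case 0
  then show ?case using assms(1) by (auto intro: bounded_linear.continuous_on)
next
  case (Suc n)
  show ?case
  proof (rule Ck_on_SucI[OF \<open>open S\<close>])
    show "((\<lambda>x. L (f x)) has_derivative (\<lambda>v. L (frechet_derivative f (at x) v))) (at x)"
      if "x \<in> S" for x
      by (rule bounded_linear.has_derivative[OF assms(1) Ck_on_SucD_derivative[OF Suc.prems that]])
    show "Ck_on n S (\<lambda>x. L (frechet_derivative f (at x) v))" for v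
      by (rule Suc.IH) (use Suc.prems in simp)
  qed
qed

lemma Ck_on_add:
  assumes "open S" and "Ck_on n S f" and "Ck_on n S g"
  shows "Ck_on n S (\<lambda>x. f x + g x)"
  using assms(2,3)
proof (induction n arbitrary: f g)
  case 0
  then show ?case by (auto intro: continuous_intros)
next
  case (Suc n)
  show ?case
  proof (rule Ck_on_SucI[OF \<open>open S\<close>])
    show "((\<lambda>x. f x + g x) has_derivative
        (\<lambda>v. frechet_derivative f (at x) v + frechet_derivative g (at x) v)) (at x)"
      if "x \<in> S" for x
      by (intro has_derivative_add Ck_on_SucD_derivative[OF Suc.prems(1) that]
        Ck_on_SucD_derivative[OF Suc.prems(2) that])
    show "Ck_on n S (\<lambda>x. frechet_derivative f (at x) v + frechet_derivative g (at x) v)" for v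
      by (rule Suc.IH) (use Suc.prems in simp_all)
  qed
qed

lemma Ck_on_scaleR:
  assumes "open S" and "Ck_on n S a" and "Ck_on n S f"
  shows "Ck_on n S (\<lambda>x. a x *\<^sub>R f x)"
  using assms(2,3)
proof (induction n arbitrary: a f)
  case 0
  then show ?case by (auto intro: continuous_intros)
next
  case (Suc n)
  show ?case
  proof (rule Ck_on_SucI[OF \<open>open S\<close>])
    show "((\<lambda>x. a x *\<^sub>R f x) has_derivative (\<lambda>v. a x *\<^sub>R frechet_derivative f (at x) v
        + frechet_derivative a (at x) v *\<^sub>R f x)) (at x)" if "x \<in> S" for x
      by (intro has_derivative_scaleR Ck_on_SucD_derivative[OF Suc.prems(1) that]
        Ck_on_SucD_derivative[OF Suc.prems(2) that])
    show "Ck_on n S (\<lambda>x. a x *\<^sub>R frechet_derivative f (at x) v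
        + frechet_derivative a (at x) v *\<^sub>R f x)" for v
      using Ck_on_SucD[OF Suc.prems(1)] Ck_on_SucD[OF Suc.prems(2)] Suc.prems
      by (intro Ck_on_add[OF \<open>open S\<close>] Suc.IH) simp_all
  qed
qed

lemma Ck_on_sum:
  assumes "open S" and "\<And>i. i \<in> I \<Longrightarrow> Ck_on n S (f i)"
  shows "Ck_on n S (\<lambda>x. \<Sum>i\<in>I. f i x)"
  using assms(2)
proof (induction I rule: infinite_finite_induct)
  case (insert i I)
  then have "Ck_on n S (\<lambda>x. f i x + (\<Sum>i\<in>I. f i x))"
    by (intro Ck_on_add[OF \<open>open S\<close>]) simp_all
  then show ?case using insert.hyps by simp
qed (simp_all add: Ck_on_const)

text \<open>The derivative of \<open>g \<circ> f\<close> in a direction \<open>v\<close> is, by expanding \<open>Df(x) v\<close> in the standard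
  basis, a sum of products of coordinates of derivatives of \<open>f\<close> with directional derivatives of
  \<open>g\<close> in \<^emph>\<open>fixed\<close> directions composed with \<open>f\<close>; so the order of differentiability can be counted
  down.\<close>

lemma Ck_on_compose:
  assumes "open S" and "open T" and "f ` S \<subseteq> T" and "Ck_on n S f" and "Ck_on n T g"
  shows "Ck_on n S (\<lambda>x. g (f x))"
  using assms(4,5)
proof (induction n arbitrary: g)
  case 0
  then show ?case using assms(3) by (auto intro: continuous_on_compose2)
next
  case (Suc n)
  let ?Df = "\<lambda>x. frechet_derivative f (at x)" and ?Dg = "\<lambda>y. frechet_derivative g (at y)"
  have d: "((\<lambda>x. g (f x)) has_derivative (\<lambda>v. ?Dg (f x) (?Df x v))) (at x)" if "x \<in> S" for x
    using diff_chain_at[OF Ck_on_SucD_derivative[OF Suc.prems(1) that]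
        Ck_on_SucD_derivative[OF Suc.prems(2), of "f x"]] that assms(3)
    by (simp add: o_def image_subset_iff)
  have e: "?Dg (f x) (?Df x v) = (\<Sum>b\<in>Basis. (?Df x v \<bullet> b) *\<^sub>R ?Dg (f x) b)" if "x \<in> S" for x v
  proof -
    have "linear (?Dg (f x))"
      using Suc.prems(2) that assms(3) by (intro linear_frechet_derivative) (simp add: image_subset_iff)
    then show ?thesis
      by (subst euclidean_representation[of "?Df x v", symmetric])
         (simp only: linear_sum linear_cmul)
  qed
  have "Ck_on n S (\<lambda>x. \<Sum>b\<in>Basis. (?Df x v \<bullet> b) *\<^sub>R ?Dg (f x) b)" for v
  proof (intro Ck_on_sum Ck_on_scaleR \<open>open S\<close>)
    fix b :: 'b
    show "Ck_on n S (\<lambda>x. ?Df x v \<bullet> b)"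
      by (rule Ck_on_bounded_linear_comp[OF bounded_linear_inner_left \<open>open S\<close>])
        (use Suc.prems in simp)
    show "Ck_on n S (\<lambda>x. ?Dg (f x) b)"
      by (rule Suc.IH[OF Ck_on_SucD[OF Suc.prems(1)]]) (use Suc.prems in simp)
  qed
  then have "Ck_on n S (\<lambda>x. ?Dg (f x) (?Df x v))" for v
    by (rule Ck_on_cong[OF \<open>open S\<close>, rotated]) (simp add: e)
  then show ?case by (intro Ck_on_SucI[OF \<open>open S\<close>, where D = "\<lambda>x v. ?Dg (f x) (?Df x v)"] d)
qed

lemma smooth_fun_on_cong:
  assumes "open S" and "\<And>x. x \<in> S \<Longrightarrow> f x = g x" and "smooth_fun_on S f"
  shows "smooth_fun_on S g"
  unfolding smooth_fun_on_def
proof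
  fix n
  have "Ck_on n S f" using assms(3) by (simp add: smooth_fun_on_def)
  from Ck_on_cong[OF assms(1) _ this] show "Ck_on n S g" using assms(2) by simp
qed

lemma smooth_fun_on_subset: "smooth_fun_on S f \<Longrightarrow> T \<subseteq> S \<Longrightarrow> smooth_fun_on T f"
  using Ck_on_subset[of _ S f T] by (simp add: smooth_fun_on_def)

lemma smooth_fun_on_compose:
  "open S \<Longrightarrow> open T \<Longrightarrow> f ` S \<subseteq> T \<Longrightarrow> smooth_fun_on S f \<Longrightarrow> smooth_fun_on T g \<Longrightarrow>
    smooth_fun_on S (\<lambda>x. g (f x))"
  using Ck_on_compose[of S T f _ g] by (simp add: smooth_fun_on_def)

lemma smooth_fun_on_const: "smooth_fun_on S (\<lambda>x. c)"
  by (simp add: smooth_fun_on_def Ck_on_const)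

lemma smooth_fun_on_id: "smooth_fun_on S (\<lambda>x. x)"
proof -
  have "Ck_on n S (\<lambda>x. x)" for n
    by (cases n) (simp_all add: Ck_on_const)
  then show ?thesis by (simp add: smooth_fun_on_def)
qed

lemma smooth_fun_on_bounded_linear_comp:
  "bounded_linear L \<Longrightarrow> open S \<Longrightarrow> smooth_fun_on S f \<Longrightarrow> smooth_fun_on S (\<lambda>x. L (f x))"
  using Ck_on_bounded_linear_comp[of L S _ f] by (simp add: smooth_fun_on_def)

lemma smooth_fun_on_add:
  "open S \<Longrightarrow> smooth_fun_on S f \<Longrightarrow> smooth_fun_on S g \<Longrightarrow> smooth_fun_on S (\<lambda>x. f x + g x)"
  using Ck_on_add[of S _ f g] by (simp add: smooth_fun_on_def)

lemma smooth_fun_on_Pair: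
  assumes "open S" "smooth_fun_on S f" "smooth_fun_on S g"
  shows "smooth_fun_on S (\<lambda>x. (f x, g x))"
proof -
  have "smooth_fun_on S (\<lambda>x. (f x, 0) + (0, g x))"
    by (intro smooth_fun_on_add assms smooth_fun_on_bounded_linear_comp[of "\<lambda>y. (y, 0)"]
        smooth_fun_on_bounded_linear_comp[of "\<lambda>y. (0, y)"] bounded_linear_Pair
        bounded_linear_ident bounded_linear_zero)
  then show ?thesis by simp
qed

lemma smooth_fun_on_differentiable:
  "smooth_fun_on S f \<Longrightarrow> x \<in> S \<Longrightarrow> f differentiable (at x)"
  unfolding smooth_fun_on_def by (drule spec[of _ "Suc 0"]) simp

lemma smooth_fun_on_continuous: "smooth_fun_on S f \<Longrightarrow> continuous_on S f"
  unfolding smooth_fun_on_def by (drule spec[of _ 0]) simp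

lemma smooth_fun_on_derivative:
  assumes "smooth_fun_on S f"
  shows "smooth_fun_on S (\<lambda>x. frechet_derivative f (at x) v)"
  unfolding smooth_fun_on_def
proof
  fix n
  have "Ck_on (Suc n) S f" using assms by (simp only: smooth_fun_on_def)
  then show "Ck_on n S (\<lambda>x. frechet_derivative f (at x) v)" by simp
qed

lemma vector_chain:
  assumes "(\<gamma> has_vector_derivative v) (at t)" and "f differentiable (at (\<gamma> t))"
  shows "((\<lambda>s. f (\<gamma> s)) has_vector_derivative frechet_derivative f (at (\<gamma> t)) v) (at t)"
proof -
  have "(f has_derivative frechet_derivative f (at (\<gamma> t))) (at (\<gamma> t))"
    using assms(2) by (simp add: frechet_derivative_works)
  from diff_chain_at[OF assms(1)[unfolded has_vector_derivative_def] this]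
  show ?thesis
    by (simp add: has_vector_derivative_def o_def linear_cmul[OF linear_frechet_derivative[OF assms(2)]])
qed

lemma directional_derivative:
  assumes "f differentiable (at p)"
  shows "((\<lambda>s. f (p + s *\<^sub>R v)) has_vector_derivative frechet_derivative f (at p) v) (at 0)"
proof -
  have "((\<lambda>s. p + s *\<^sub>R v) has_vector_derivative v) (at 0)"
    by (auto intro!: derivative_eq_intros)
  from vector_chain[OF this, of f] assms show ?thesis by simp
qed

section \<open>Solutions of autonomous differential equations\<close>

lemma smooth_imp_lipschitz_on_cball:
  fixes f :: "'a::euclidean_space \<Rightarrow> 'b::euclidean_space"
  assumes "smooth_fun_on S f" and "cball p r \<subseteq> S"
  shows "\<exists>L\<ge>0. L-lipschitz_on (cball p r) f"
proof -
  let ?D = "\<lambda>x. frechet_derivative f (at x)"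
  have "\<exists>M. \<forall>x\<in>cball p r. norm (?D x b) \<le> M" for b
  proof -
    have "continuous_on (cball p r) (\<lambda>x. ?D x b)"
      using assms smooth_fun_on_continuous smooth_fun_on_derivative continuous_on_subset by metis
    then have "bounded ((\<lambda>x. ?D x b) ` cball p r)"
      by (intro compact_imp_bounded compact_continuous_image) auto
    then show ?thesis by (auto simp: bounded_iff)
  qed
  then obtain M where M: "\<And>b x. x \<in> cball p r \<Longrightarrow> norm (?D x b) \<le> M b" by metis
  let ?L = "\<Sum>b\<in>Basis. \<bar>M b\<bar>"
  have der: "(f has_derivative ?D x) (at x)" if "x \<in> cball p r" for x
    using smooth_fun_on_differentiable[OF assms(1)] assms(2) that by (auto simp: frechet_derivative_works)
  have on: "onorm (?D x) \<le> ?L" if x: "x \<in> cball p r" for x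
  proof (rule onorm_le)
    fix v
    have lin: "linear (?D x)"
      using der[OF x] has_derivative_linear by blast
    have "?D x v = (\<Sum>b\<in>Basis. (v \<bullet> b) *\<^sub>R ?D x b)"
      by (subst euclidean_representation[of v, symmetric])
         (simp only: linear_sum[OF lin] linear_cmul[OF lin])
    also have "norm \<dots> \<le> (\<Sum>b\<in>Basis. norm ((v \<bullet> b) *\<^sub>R ?D x b))" by (rule norm_sum)
    also have "\<dots> \<le> (\<Sum>b\<in>Basis. norm v * \<bar>M b\<bar>)"
    proof (rule sum_mono)
      fix b :: 'a assume "b \<in> Basis"
      then show "norm ((v \<bullet> b) *\<^sub>R ?D x b) \<le> norm v * \<bar>M b\<bar>"
        using M[OF x, of b] by (auto intro!: mult_mono Basis_le_norm)
    qed
    finally show "norm (?D x v) \<le> ?L * norm v"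
      by (simp add: sum_distrib_right sum_distrib_left mult.commute)
  qed
  have "?L-lipschitz_on (cball p r) f"
  proof (rule lipschitz_onI)
    show "dist (f x) (f y) \<le> ?L * dist x y" if "x \<in> cball p r" "y \<in> cball p r" for x y
      unfolding dist_norm
      by (rule differentiable_bound[OF convex_cball has_derivative_at_withinI[OF der] on that])
  qed (simp add: sum_nonneg)
  then show ?thesis by (meson sum_nonneg abs_ge_zero)
qed

text \<open>The Picard operator is a contraction on bounded continuous functions on the whole line once time is
  clamped to a short interval \<open>[-e, e]\<close>. The integral from \<open>0\<close> to \<open>t\<close>, whose sign varies, is written
  as a difference of integrals starting at \<open>-e\<close>.\<close>

lemma picard_lindelof_lipschitz:
  fixes f :: "'a::euclidean_space \<Rightarrow> 'a"
  assumes L: "L-lipschitz_on UNIV f" and B: "\<And>x. norm (f x) \<le> B"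
  shows "\<exists>e>0. \<exists>u. u 0 = x0 \<and> (\<forall>t. \<bar>t\<bar> < e \<longrightarrow> (u has_vector_derivative f (u t)) (at t))"
proof -
  define e where "e = 1 / (4 * (L + 1))"
  have L0: "0 \<le> L" using L lipschitz_on_nonneg by blast
  have e: "e > 0" "2 * e * L \<le> 1/2" using L0 by (auto simp: e_def field_simps)
  define c where "c t = max (-e) (min e t)" for t :: real
  have c: "c t \<in> {-e..e}" "\<bar>t\<bar> \<le> e \<Longrightarrow> c t = t" for t using e by (auto simp: c_def)
  have cc: "continuous_on UNIV c" unfolding c_def by (intro continuous_intros)
  define P where "P u t = x0 + (integral {-e..c t} (\<lambda>s. f (u s)) - integral {-e..0} (\<lambda>s. f (u s)))"
    for u :: "real \<Rightarrow> 'a" and t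
  have fu: "continuous_on T (\<lambda>s. f (u s))" if "continuous_on UNIV u" for u :: "real \<Rightarrow> 'a" and T
    using continuous_on_compose2[OF lipschitz_on_continuous_on[OF L] that] continuous_on_subset
    by blast
  have Pc: "continuous_on UNIV (P u)" if "continuous_on UNIV u" for u
  proof -
    have "continuous_on {-e..e} (\<lambda>x. integral {-e..x} (\<lambda>s. f (u s)))"
      by (rule indefinite_integral_continuous_1) (intro integrable_continuous_real fu that)
    from continuous_on_compose2[OF this cc] c(1)
    have "continuous_on UNIV (\<lambda>t. integral {-e..c t} (\<lambda>s. f (u s)))" by blast
    then show ?thesis unfolding P_def by (intro continuous_intros)
  qed
  have split: "integral {-e..c t} g - integral {-e..0} g =
     (if 0 \<le> c t then integral {0..c t} g else - integral {c t..0} g)"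
    if "continuous_on UNIV g" for g :: "real \<Rightarrow> 'a" and t
  proof -
    have i: "g integrable_on {a..b}" for a b
      using that by (intro integrable_continuous_real) (auto intro: continuous_on_subset)
    show ?thesis
    proof (cases "0 \<le> c t")
      case True
      then have "integral {-e..0} g + integral {0..c t} g = integral {-e..c t} g"
        using e by (intro Henstock_Kurzweil_Integration.integral_combine i) auto
      then show ?thesis using True by (simp add: algebra_simps)
    next
      case False
      then have "integral {-e..c t} g + integral {c t..0} g = integral {-e..0} g"
        using e c(1)[of t] by (intro Henstock_Kurzweil_Integration.integral_combine i) auto
      then show ?thesis using False by (simp add: algebra_simps)
    qed
  qed
  have bnd: "norm (integral {-e..c t} g - integral {-e..0} g) \<le> b * e"
    if "continuous_on UNIV g" "\<And>s. norm (g s) \<le> b" for g :: "real \<Rightarrow> 'a" and t b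
  proof -
    have b0: "0 \<le> b" using norm_ge_zero that(2) order_trans by blast
    have i: "norm (integral {x..y} g) \<le> b * e" if "x \<le> y" "y - x \<le> e" for x y
    proof -
      have "norm (integral {x..y} g) \<le> b * (y - x)"
        using that \<open>continuous_on UNIV g\<close> \<open>\<And>s. norm (g s) \<le> b\<close>
        by (intro integral_bound) (auto intro: continuous_on_subset)
      also have "\<dots> \<le> b * e" using that b0 by (intro mult_left_mono) auto
      finally show ?thesis .
    qed
    show ?thesis
      unfolding split[OF that(1)] using c(1)[of t] by (auto intro!: i)
  qed
  have Pb: "P u \<in> bcontfun" if "continuous_on UNIV u" for u
  proof (rule bcontfun_normI[OF Pc[OF that]])
    fix t
    have "norm (P u t) \<le> norm x0 + norm (integral {-e..c t} (\<lambda>s. f (u s)) - integral {-e..0} (\<lambda>s. f (u s)))"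
      unfolding P_def by (rule norm_triangle_ineq)
    also have "\<dots> \<le> norm x0 + B * e" using bnd[OF fu[OF that]] B by auto
    finally show "norm (P u t) \<le> norm x0 + B * e" .
  qed
  define T where "T u = Bcontfun (P (apply_bcontfun u))" for u :: "real \<Rightarrow>\<^sub>C 'a"
  have T: "apply_bcontfun (T u) = P (apply_bcontfun u)" for u
    unfolding T_def by (intro Bcontfun_inverse Pb) auto
  have contr: "dist (T u) (T v) \<le> 1/2 * dist u v" for u v
  proof (rule dist_bound)
    fix t
    let ?g = "\<lambda>s. f (apply_bcontfun u s) - f (apply_bcontfun v s)"
    have i: "(\<lambda>s. f (apply_bcontfun w s)) integrable_on {a..b}"
      for w :: "real \<Rightarrow>\<^sub>C 'a" and a b
      by (intro integrable_continuous_real fu) auto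
    have "dist (apply_bcontfun (T u) t) (apply_bcontfun (T v) t)
       = norm (integral {-e..c t} ?g - integral {-e..0} ?g)"
      by (simp add: T P_def dist_norm integral_diff[OF i i] algebra_simps)
    also have "\<dots> \<le> (L * dist u v) * e"
    proof (rule bnd)
      show "continuous_on UNIV ?g" by (intro continuous_intros fu) auto
      fix s
      have "norm (?g s) \<le> L * dist (apply_bcontfun u s) (apply_bcontfun v s)"
        using lipschitz_onD[OF L] by (simp add: dist_norm)
      also have "\<dots> \<le> L * dist u v" by (intro mult_left_mono dist_bounded L0)
      finally show "norm (?g s) \<le> L * dist u v" .
    qed
    also have "\<dots> = (e * L) * dist u v" by simp
    also have "\<dots> \<le> 1/2 * dist u v"
      using e L0 by (intro mult_right_mono) (auto simp: zero_le_mult_iff intro: order_trans[of _ "2 * e * L"])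
    finally show "dist (apply_bcontfun (T u) t) (apply_bcontfun (T v) t) \<le> 1/2 * dist u v" .
  qed
  obtain u where u: "T u = u"
    using banach_fix_type[of "1/2" T] contr by auto
  have uP: "apply_bcontfun u t = P (apply_bcontfun u) t" for t using T[of u] u by simp
  show ?thesis
  proof (intro exI conjI allI impI)
    show "e > 0" by (rule e)
    show "apply_bcontfun u 0 = x0" using c(2)[of 0] e by (subst uP) (simp add: P_def)
    fix t assume t: "\<bar>t\<bar> < e"
    have "((\<lambda>x. integral {-e..x} (\<lambda>s. f (apply_bcontfun u s))) has_vector_derivative
        f (apply_bcontfun u t)) (at t within {-e..e})"
      by (rule integral_has_vector_derivative) (use t in \<open>auto intro!: fu\<close>)
    then have "((\<lambda>x. integral {-e..x} (\<lambda>s. f (apply_bcontfun u s))) has_vector_derivative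
        f (apply_bcontfun u t)) (at t)"
      using t at_within_interior[of t "{-e..e}"] by (auto simp: abs_less_iff)
    then have "((\<lambda>x. x0 + (integral {-e..x} (\<lambda>s. f (apply_bcontfun u s))
        - integral {-e..0} (\<lambda>s. f (apply_bcontfun u s)))) has_vector_derivative
        0 + (f (apply_bcontfun u t) - 0)) (at t)"
      by (intro has_vector_derivative_add has_vector_derivative_diff has_vector_derivative_const)
    then have d: "((\<lambda>x. x0 + (integral {-e..x} (\<lambda>s. f (apply_bcontfun u s))
        - integral {-e..0} (\<lambda>s. f (apply_bcontfun u s)))) has_vector_derivative
        f (apply_bcontfun u t)) (at t)" by simp
    show "(apply_bcontfun u has_vector_derivative f (apply_bcontfun u t)) (at t)"
    proof (rule has_vector_derivative_transform_within_open[OF d])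
      show "open {-e<..<e}" "t \<in> {-e<..<e}" using t by auto
      fix x assume "x \<in> {-e<..<e}"
      then have "c x = x" by (intro c(2)) auto
      then show "x0 + (integral {-e..x} (\<lambda>s. f (apply_bcontfun u s))
        - integral {-e..0} (\<lambda>s. f (apply_bcontfun u s))) = apply_bcontfun u x"
        by (subst uP) (simp add: P_def)
    qed
  qed
qed

text \<open>Composing a locally defined vector field with the nearest-point retraction onto a closed ball
  makes it bounded and globally Lipschitz without changing it near the initial point.\<close>

lemma autonomous_ode_local_solution:
  fixes f :: "'a::euclidean_space \<Rightarrow> 'a"
  assumes "open V" and "smooth_fun_on V f" and "x0 \<in> V"
  shows "\<exists>e>0. \<exists>u. u 0 = x0 \<and> u ` {-e<..<e} \<subseteq> V \<and> smooth_fun_on {-e<..<e} u \<and>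
    (\<forall>t\<in>{-e<..<e}. (u has_vector_derivative f (u t)) (at t))"
proof -
  obtain r where r: "r > 0" "cball x0 r \<subseteq> V" using assms open_contains_cball by blast
  let ?C = "cball x0 r"
  have C: "closed ?C" "convex ?C" "?C \<noteq> {}" using r by auto
  obtain L where L: "L-lipschitz_on ?C f" "L \<ge> 0"
    using smooth_imp_lipschitz_on_cball[OF assms(2) r(2)] by blast
  let ?g = "\<lambda>x. f (closest_point ?C x)"
  have cp: "closest_point ?C x \<in> ?C" for x using C closest_point_in_set by blast
  have "L-lipschitz_on UNIV ?g"
  proof (rule lipschitz_onI[OF _ L(2)])
    fix x y
    have "dist (?g x) (?g y) \<le> L * dist (closest_point ?C x) (closest_point ?C y)"
      using lipschitz_onD[OF L(1) cp cp] .
    also have "\<dots> \<le> L * dist x y"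
      by (intro mult_left_mono closest_point_lipschitz C L(2))
    finally show "dist (?g x) (?g y) \<le> L * dist x y" .
  qed
  moreover have "\<exists>B. \<forall>x. norm (?g x) \<le> B"
  proof -
    have "bounded (f ` ?C)"
      by (rule compact_imp_bounded[OF compact_continuous_image[OF
            lipschitz_on_continuous_on[OF L(1)] compact_cball]])
    then obtain B where "\<And>y. y \<in> f ` ?C \<Longrightarrow> norm y \<le> B" unfolding bounded_iff by blast
    then have "norm (?g x) \<le> B" for x using cp[of x] by blast
    then show ?thesis by blast
  qed
  ultimately obtain d u where d: "d > 0" and u: "u 0 = x0"
    "\<And>t. \<bar>t\<bar> < d \<Longrightarrow> (u has_vector_derivative ?g (u t)) (at t)"
    using picard_lindelof_lipschitz[of L ?g] by metis
  have "continuous (at 0) u" using u(2)[of 0] d has_vector_derivative_continuous by auto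
  then obtain e0 where e0: "e0 > 0" "\<And>t. \<bar>t\<bar> < e0 \<Longrightarrow> dist (u t) x0 < r"
    using r(1) u(1) by (auto simp: continuous_at_eps_delta dist_norm)
  define e where "e = min d e0"
  let ?I = "{-e<..<e}"
  have e: "e > 0" "\<And>t. t \<in> ?I \<Longrightarrow> u t \<in> ?C" "\<And>t. t \<in> ?I \<Longrightarrow> \<bar>t\<bar> < d"
    using d e0 by (auto simp: e_def dist_commute less_imp_le abs_less_iff)
  have V: "u ` ?I \<subseteq> V" using e(2) r(2) by blast
  have der: "(u has_vector_derivative f (u t)) (at t)" if "t \<in> ?I" for t
    using u(2)[OF e(3)[OF that]] closest_point_self[OF e(2)[OF that]] by simp
  have "Ck_on n ?I u" for n
  proof (induction n)
    case 0
    show ?case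
      using has_vector_derivative_continuous[OF der] by (simp add: continuous_at_imp_continuous_on)
  next
    case (Suc n)
    have "Ck_on n ?I (\<lambda>t. v *\<^sub>R f (u t))" for v
      by (intro Ck_on_bounded_linear_comp[OF bounded_linear_scaleR_right]
          Ck_on_compose[OF _ \<open>open V\<close> V Suc.IH])
        (use assms(2) in \<open>auto simp: smooth_fun_on_def\<close>)
    then show ?case
      by (intro Ck_on_SucI[where D = "\<lambda>t v. v *\<^sub>R f (u t)"]
          der[unfolded has_vector_derivative_def]) auto
  qed
  then have "smooth_fun_on ?I u" by (simp add: smooth_fun_on_def)
  with e(1) u(1) V der show ?thesis by blast
qed

section \<open>Smooth maps into a Lie group\<close>

lemma smooth_into_subset:
  assumes "smooth_into G D f" and "open D'" and "D' \<subseteq> D"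
  shows "smooth_into G D' f"
  unfolding smooth_into_def
proof
  fix p assume p: "p \<in> D'"
  then obtain c N where c: "c \<in> atlas G" "open N" "p \<in> N" "f ` N \<subseteq> fst c"
    "smooth_fun_on N (snd c \<circ> f)"
    using assms(1,3) unfolding smooth_into_def by blast
  show "\<exists>c\<in>atlas G. \<exists>N. open N \<and> p \<in> N \<and> N \<subseteq> D' \<and> f ` N \<subseteq> fst c \<and> smooth_fun_on N (snd c \<circ> f)"
  proof (intro bexI[OF _ c(1)] exI[of _ "N \<inter> D'"] conjI)
    show "smooth_fun_on (N \<inter> D') (snd c \<circ> f)" by (rule smooth_fun_on_subset[OF c(5)]) simp
  qed (use c p assms(2) in auto)
qed

lemma smooth_into_local:
  assumes "\<And>p. p \<in> D \<Longrightarrow> \<exists>N. open N \<and> p \<in> N \<and> N \<subseteq> D \<and> smooth_into G N f"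
  shows "smooth_into G D f"
  unfolding smooth_into_def
proof
  fix p assume "p \<in> D"
  then obtain N where N: "p \<in> N" "N \<subseteq> D" "smooth_into G N f" using assms by blast
  then obtain c M where "c \<in> atlas G" "open M" "p \<in> M" "M \<subseteq> N" "f ` M \<subseteq> fst c"
    "smooth_fun_on M (snd c \<circ> f)"
    unfolding smooth_into_def by blast
  with N(2) show "\<exists>c\<in>atlas G. \<exists>N. open N \<and> p \<in> N \<and> N \<subseteq> D \<and> f ` N \<subseteq> fst c \<and> smooth_fun_on N (snd c \<circ> f)"
    by (meson order_trans)
qed

lemma smooth_into_cong:
  assumes "smooth_into G D f" and "\<And>p. p \<in> D \<Longrightarrow> f p = g p"
  shows "smooth_into G D g"
  unfolding smooth_into_def
proof
  fix p assume "p \<in> D"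
  then obtain c N where c: "c \<in> atlas G" "open N" "p \<in> N" "N \<subseteq> D" "f ` N \<subseteq> fst c"
    "smooth_fun_on N (snd c \<circ> f)"
    using assms(1) unfolding smooth_into_def by blast
  have eq: "f q = g q" if "q \<in> N" for q using assms(2) c(4) that by blast
  have "smooth_fun_on N (snd c \<circ> g)"
    by (rule smooth_fun_on_cong[OF c(2) _ c(6)]) (simp add: eq)
  moreover have "g ` N \<subseteq> fst c" using c(5) eq by (simp add: image_subset_iff)
  ultimately show "\<exists>c\<in>atlas G. \<exists>N. open N \<and> p \<in> N \<and> N \<subseteq> D \<and> g ` N \<subseteq> fst c \<and> smooth_fun_on N (snd c \<circ> g)"
    using c(1-4) by blast
qed

lemma smooth_into_compose:
  assumes "open D'" and "smooth_fun_on D' \<sigma>" and "\<sigma> ` D' \<subseteq> D" and "smooth_into G D f"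
  shows "smooth_into G D' (\<lambda>x. f (\<sigma> x))"
  unfolding smooth_into_def
proof
  fix p assume p: "p \<in> D'"
  then have "\<sigma> p \<in> D" using assms(3) by blast
  then obtain c N where c: "c \<in> atlas G" "open N" "\<sigma> p \<in> N" "f ` N \<subseteq> fst c"
    "smooth_fun_on N (snd c \<circ> f)"
    using assms(4) unfolding smooth_into_def by blast
  let ?M = "D' \<inter> \<sigma> -` N"
  have M: "open ?M"
    by (rule continuous_open_preimage[OF smooth_fun_on_continuous[OF assms(2)] assms(1) c(2)])
  have "smooth_fun_on ?M (\<lambda>x. (snd c \<circ> f) (\<sigma> x))"
    by (rule smooth_fun_on_compose[OF M c(2) _ smooth_fun_on_subset[OF assms(2)] c(5)]) auto
  then have "smooth_fun_on ?M (snd c \<circ> (\<lambda>x. f (\<sigma> x)))" by (simp add: o_def)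
  moreover have "(\<lambda>x. f (\<sigma> x)) ` ?M \<subseteq> fst c" using c(4) by (simp add: image_subset_iff)
  moreover have "p \<in> ?M" "?M \<subseteq> D'" using p c(3) by simp_all
  ultimately show "\<exists>c\<in>atlas G. \<exists>N. open N \<and> p \<in> N \<and> N \<subseteq> D' \<and> (\<lambda>x. f (\<sigma> x)) ` N \<subseteq> fst c
      \<and> smooth_fun_on N (snd c \<circ> (\<lambda>x. f (\<sigma> x)))"
    using c(1) M by blast
qed

locale lie_grp = group G for G :: "('g, 'e::euclidean_space) lie_group_data" (structure) +
  assumes lie_group: "lie_group G"
begin

lemma topspace_carrier: "topspace (topo G) = carrier G"
  using lie_group by (simp add: lie_group_def)

lemma manifold: "smooth_manifold (topo G) (atlas G)"
  using lie_group by (simp add: lie_group_def)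

context
  fixes c assumes c: "c \<in> atlas G"
begin

lemma chart_openin: "openin (topo G) (fst c)"
  using manifold c by (simp add: smooth_manifold_def)

lemma open_chart_image: "open (chart_image c)"
  using manifold c by (simp add: smooth_manifold_def)

lemma chart_homeomorphic:
  "homeomorphic_map (subtopology (topo G) (fst c)) (top_of_set (chart_image c)) (snd c)"
  using manifold c by (simp add: smooth_manifold_def)

lemma chart_carrier: "x \<in> fst c \<Longrightarrow> x \<in> carrier G"
  using openin_subset[OF chart_openin] topspace_carrier by auto

lemma chart_inj: "inj_on (snd c) (fst c)"
proof -
  have "topspace (subtopology (topo G) (fst c)) = fst c"
    using openin_subset[OF chart_openin] by (simp add: Int_absorb1)
  then show ?thesis
    using homeomorphic_imp_injective_map[OF chart_homeomorphic] by simp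
qed

lemma chart_in_image: "x \<in> fst c \<Longrightarrow> snd c x \<in> chart_image c"
  by (simp add: chart_image_def)

lemma chart_inv_in: "u \<in> chart_image c \<Longrightarrow> chart_inv c u \<in> fst c"
  unfolding chart_image_def chart_inv_def by (rule inv_into_into)

lemma chart_chart_inv: "u \<in> chart_image c \<Longrightarrow> snd c (chart_inv c u) = u"
  unfolding chart_image_def chart_inv_def by (rule f_inv_into_f)

lemma chart_inv_chart: "x \<in> fst c \<Longrightarrow> chart_inv c (snd c x) = x"
  unfolding chart_inv_def by (rule inv_into_f_f[OF chart_inj])

lemma open_chart_of_openin:
  assumes "openin (topo G) W"
  shows "open (snd c ` (fst c \<inter> W))"
proof -
  have "openin (subtopology (topo G) (fst c)) (fst c \<inter> W)"
    using assms by (rule openin_subtopology_Int2)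
  then have "openin (top_of_set (chart_image c)) (snd c ` (fst c \<inter> W))"
    using homeomorphic_imp_open_map[OF chart_homeomorphic] by (simp add: open_map_def)
  then show ?thesis
    using open_chart_image openin_open_eq by blast
qed

end

lemma smooth_into_chart_preimage:
  assumes "smooth_into G D f" and "p \<in> D" and "openin (topo G) W" and "f p \<in> W"
  shows "\<exists>d\<in>atlas G. \<exists>N. open N \<and> p \<in> N \<and> N \<subseteq> D \<and> f ` N \<subseteq> fst d \<inter> W \<and>
    smooth_fun_on N (snd d \<circ> f)"
proof -
  obtain d N where d: "d \<in> atlas G" "open N" "p \<in> N" "N \<subseteq> D" "f ` N \<subseteq> fst d"
    "smooth_fun_on N (snd d \<circ> f)"
    using assms(1,2) unfolding smooth_into_def by blast
  let ?M = "N \<inter> (snd d \<circ> f) -` (snd d ` (fst d \<inter> W))"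
  have "open ?M"
    by (rule continuous_open_preimage[OF smooth_fun_on_continuous[OF d(6)] d(2)
          open_chart_of_openin[OF d(1) assms(3)]])
  moreover have "p \<in> ?M" using d(3,5) assms(4) by (simp add: image_subset_iff)
  moreover have "f q \<in> fst d \<inter> W" if q: "q \<in> ?M" for q
  proof -
    obtain y where y: "y \<in> fst d" "y \<in> W" "snd d (f q) = snd d y" using q by auto
    moreover have "f q \<in> fst d" using q d(5) by blast
    ultimately have "f q = y" using chart_inj[OF d(1)] by (simp add: inj_on_eq_iff)
    with y show ?thesis by simp
  qed
  moreover have "smooth_fun_on ?M (snd d \<circ> f)" by (rule smooth_fun_on_subset[OF d(6)]) simp
  ultimately show ?thesis using d(1,4) by (meson image_subsetI le_infI1)
qed

text \<open>Smoothness, defined by means of some chart near each point, may be tested in every chart, as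
  the transition maps are smooth.\<close>

lemma smooth_into_chart:
  assumes "smooth_into G D f" and "p \<in> D" and c: "c \<in> atlas G" and "f p \<in> fst c"
  shows "\<exists>N. open N \<and> p \<in> N \<and> N \<subseteq> D \<and> f ` N \<subseteq> fst c \<and> smooth_fun_on N (\<lambda>q. snd c (f q))"
proof -
  obtain d N where d: "d \<in> atlas G" and N: "open N" "p \<in> N" "N \<subseteq> D" "f ` N \<subseteq> fst d \<inter> fst c"
    "smooth_fun_on N (snd d \<circ> f)"
    using smooth_into_chart_preimage[OF assms(1,2) chart_openin[OF c] assms(4)] by blast
  let ?O = "snd d ` (fst d \<inter> fst c)"
  have "smooth_fun_on ?O (snd c \<circ> chart_inv d)"
    using manifold c d by (simp add: smooth_manifold_def)
  moreover have "open ?O" by (rule open_chart_of_openin[OF d chart_openin[OF c]])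
  moreover have "(snd d \<circ> f) ` N \<subseteq> ?O" using N(4) by (simp add: image_subset_iff)
  ultimately have "smooth_fun_on N (\<lambda>q. (snd c \<circ> chart_inv d) ((snd d \<circ> f) q))"
    using smooth_fun_on_compose[OF N(1)] N(5) by blast
  then have "smooth_fun_on N (\<lambda>q. snd c (f q))"
  proof (rule smooth_fun_on_cong[OF N(1), rotated])
    fix q assume "q \<in> N"
    then have "f q \<in> fst d" using N(4) by blast
    then show "(snd c \<circ> chart_inv d) ((snd d \<circ> f) q) = snd c (f q)"
      by (simp add: chart_inv_chart[OF d])
  qed
  with N show ?thesis by (metis le_inf_iff)
qed

lemma smooth_into_carrier:
  assumes "smooth_into G D f" and "p \<in> D"
  shows "f p \<in> carrier G"
proof -
  obtain c N where "c \<in> atlas G" "p \<in> N" "f ` N \<subseteq> fst c"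
    using assms unfolding smooth_into_def by blast
  then show ?thesis using chart_carrier by blast
qed

lemma obtain_chart:
  assumes "g \<in> carrier G"
  obtains c where "c \<in> atlas G" "g \<in> fst c"
  using assms manifold topspace_carrier unfolding smooth_manifold_def by blast

lemma smooth_into_const:
  assumes "g \<in> carrier G" and "open D"
  shows "smooth_into G D (\<lambda>p. g)"
proof -
  obtain c where c: "c \<in> atlas G" "g \<in> fst c" using obtain_chart[OF assms(1)] .
  show ?thesis
    unfolding smooth_into_def
  proof (intro ballI bexI[OF _ c(1)] exI[of _ D] conjI)
    show "smooth_fun_on D (snd c \<circ> (\<lambda>p. g))" by (simp add: o_def smooth_fun_on_const)
  qed (use c assms in auto)
qed

lemma smooth_into_chart_inv:
  assumes "c \<in> atlas G"
  shows "smooth_into G (chart_image c) (chart_inv c)"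
  unfolding smooth_into_def
proof (intro ballI bexI[OF _ assms] exI[of _ "chart_image c"] conjI)
  show "smooth_fun_on (chart_image c) (snd c \<circ> chart_inv c)"
    by (rule smooth_fun_on_cong[OF open_chart_image[OF assms] _ smooth_fun_on_id])
      (simp add: chart_chart_inv[OF assms])
  show "chart_inv c ` chart_image c \<subseteq> fst c"
    by (simp add: image_subset_iff chart_inv_in[OF assms])
qed (simp_all add: open_chart_image[OF assms])

lemma smooth_into_mult:
  assumes "open D" and f: "smooth_into G D f" and g: "smooth_into G D g"
  shows "smooth_into G D (\<lambda>p. f p \<otimes> g p)"
proof (rule smooth_into_local)
  fix p assume p: "p \<in> D"
  obtain c M where c: "c \<in> atlas G" "open M" "p \<in> M" "M \<subseteq> D" "f ` M \<subseteq> fst c"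
    "smooth_fun_on M (snd c \<circ> f)"
    using f p unfolding smooth_into_def by blast
  obtain d N where d: "d \<in> atlas G" "open N" "p \<in> N" "N \<subseteq> D" "g ` N \<subseteq> fst d"
    "smooth_fun_on N (snd d \<circ> g)"
    using g p unfolding smooth_into_def by blast
  let ?O = "M \<inter> N"
  have O: "open ?O" using c(2) d(2) by blast
  have cf: "f q \<in> fst c" and dg: "g q \<in> fst d" if "q \<in> ?O" for q using c(5) d(5) that by blast+
  have "smooth_into G ?O (\<lambda>q. (\<lambda>(u, v). chart_inv c u \<otimes> chart_inv d v) ((snd c \<circ> f) q, (snd d \<circ> g) q))"
  proof (rule smooth_into_compose[OF O])
    show "smooth_fun_on ?O (\<lambda>q. ((snd c \<circ> f) q, (snd d \<circ> g) q))"
      by (intro smooth_fun_on_Pair[OF O] smooth_fun_on_subset[OF c(6)] smooth_fun_on_subset[OF d(6)])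
        auto
    show "(\<lambda>q. ((snd c \<circ> f) q, (snd d \<circ> g) q)) ` ?O \<subseteq> chart_image c \<times> chart_image d"
      using chart_in_image[OF c(1)] chart_in_image[OF d(1)] cf dg by auto
    show "smooth_into G (chart_image c \<times> chart_image d) (\<lambda>(u, v). chart_inv c u \<otimes> chart_inv d v)"
      using lie_group c(1) d(1) by (simp add: lie_group_def)
  qed
  then have "smooth_into G ?O (\<lambda>q. f q \<otimes> g q)"
    by (rule smooth_into_cong)
      (simp add: chart_inv_chart[OF c(1) cf] chart_inv_chart[OF d(1) dg])
  moreover have "p \<in> ?O" "?O \<subseteq> D" using c d by blast+
  ultimately show "\<exists>N. open N \<and> p \<in> N \<and> N \<subseteq> D \<and> smooth_into G N (\<lambda>p. f p \<otimes> g p)"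
    using O by blast
qed

lemma smooth_into_self_map:
  assumes "open D" and f: "smooth_into G D f" and s: "smooth_self_map G s"
  shows "smooth_into G D (\<lambda>p. s (f p))"
proof (rule smooth_into_local)
  fix p assume p: "p \<in> D"
  obtain c M where c: "c \<in> atlas G" "open M" "p \<in> M" "M \<subseteq> D" "f ` M \<subseteq> fst c"
    "smooth_fun_on M (snd c \<circ> f)"
    using f p unfolding smooth_into_def by blast
  have cf: "f q \<in> fst c" if "q \<in> M" for q using c(5) that by blast
  have "smooth_into G M (\<lambda>q. (s \<circ> chart_inv c) ((snd c \<circ> f) q))"
  proof (rule smooth_into_compose[OF c(2,6)])
    show "(snd c \<circ> f) ` M \<subseteq> chart_image c" using chart_in_image[OF c(1)] cf by auto
    show "smooth_into G (chart_image c) (s \<circ> chart_inv c)"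
      using s c(1) by (simp add: smooth_self_map_def)
  qed
  then have "smooth_into G M (\<lambda>q. s (f q))"
    by (rule smooth_into_cong) (simp add: chart_inv_chart[OF c(1) cf])
  then show "\<exists>N. open N \<and> p \<in> N \<and> N \<subseteq> D \<and> smooth_into G N (\<lambda>p. s (f p))"
    using c by blast
qed

lemma smooth_into_inv:
  assumes "open D" and "smooth_into G D f"
  shows "smooth_into G D (\<lambda>p. inv (f p))"
  using smooth_into_self_map[OF assms, of "\<lambda>g. inv g"] lie_group by (simp add: lie_group_def)

lemma smooth_into_continuous_map:
  assumes "smooth_into G UNIV f"
  shows "continuous_map euclidean (topo G) f"
  unfolding continuous_map_def
proof (intro conjI allI impI)
  show "f \<in> topspace euclidean \<rightarrow> topspace (topo G)"
    using smooth_into_carrier[OF assms] topspace_carrier by auto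
  fix W assume W: "openin (topo G) W"
  have "\<exists>N. open N \<and> p \<in> N \<and> N \<subseteq> {x. f x \<in> W}" if "f p \<in> W" for p
    using smooth_into_chart_preimage[OF assms UNIV_I W that] by (auto simp: image_subset_iff)
  then have "open {x. f x \<in> W}" by (subst open_subopen) auto
  then show "openin euclidean {x \<in> topspace euclidean. f x \<in> W}" by simp
qed

end

section \<open>Tangent vectors at the identity and logarithmic derivatives\<close>

lemma eventually_nhds_in_open:
  assumes "isCont f x" and "open S" and "f x \<in> S"
  shows "eventually (\<lambda>y. f y \<in> S) (nhds x)"
proof -
  have "(f \<longlongrightarrow> f x) (nhds x)"
    using assms(1) by (simp add: isCont_def tendsto_at_iff_tendsto_nhds)
  then show ?thesis by (rule topological_tendstoD[OF _ assms(2,3)])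
qed

lemma has_vector_derivative_cong_nhds:
  assumes "(f has_vector_derivative v) (at x)" and "eventually (\<lambda>s. f s = g s) (nhds x)"
  shows "(g has_vector_derivative v) (at x)"
proof -
  obtain S where S: "open S" "x \<in> S" "\<And>s. s \<in> S \<Longrightarrow> f s = g s"
    using assms(2) unfolding eventually_nhds by blast
  show ?thesis by (rule has_vector_derivative_transform_within_open[OF assms(1) S])
qed

lemma open_line_preimage:
  fixes p v :: "'a::real_normed_vector"
  assumes "open D"
  shows "open {s. p + s *\<^sub>R v \<in> D}"
proof -
  have "open ((\<lambda>s. p + s *\<^sub>R v) -` D)"
    by (rule open_vimage[OF assms]) (intro continuous_intros)
  then show ?thesis by (simp add: vimage_def)
qed

lemma smooth_fun_on_line: "smooth_fun_on S (\<lambda>s. p + s *\<^sub>R v)" if "open S"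
  by (intro smooth_fun_on_add[OF that] smooth_fun_on_const
      smooth_fun_on_bounded_linear_comp[OF bounded_linear_scaleR_left that smooth_fun_on_id])

text \<open>The left logarithmic (Darboux) derivative \<open>f\<inverse> df\<close>: the pullback of the Maurer--Cartan form along
  \<open>f\<close>. The domain is arbitrary, as the line is needed for one-parameter subgroups and the plane for
  frames.\<close>

definition darboux ::
    "('g, 'e::euclidean_space) lie_group_data \<Rightarrow> ('d::real_vector \<Rightarrow> 'g) \<Rightarrow> 'd \<Rightarrow> 'd \<Rightarrow> 'e" where
  "darboux G f p v = velocity G (\<lambda>s. inv\<^bsub>G\<^esub> (f p) \<otimes>\<^bsub>G\<^esub> f (p + s *\<^sub>R v))"

context lie_grp
begin

abbreviation "U1 \<equiv> fst (chart_one G)"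
abbreviation "co \<equiv> snd (chart_one G)"
abbreviation "coi \<equiv> chart_inv (chart_one G)"
abbreviation "e0 \<equiv> coord_one G"

lemma chart_one_atlas: "chart_one G \<in> atlas G" and one_in_U1: "\<one> \<in> U1"
proof -
  have "\<exists>c. c \<in> atlas G \<and> \<one> \<in> fst c" using obtain_chart[OF one_closed] by blast
  from someI_ex[OF this] show "chart_one G \<in> atlas G" "\<one> \<in> U1"
    unfolding chart_one_def by auto
qed

lemma e0_image: "e0 \<in> chart_image (chart_one G)"
  unfolding coord_one_def by (rule chart_in_image[OF chart_one_atlas one_in_U1])

lemma coi_e0: "coi e0 = \<one>"
  unfolding coord_one_def by (rule chart_inv_chart[OF chart_one_atlas one_in_U1])

lemma coi_carrier: "u \<in> chart_image (chart_one G) \<Longrightarrow> coi u \<in> carrier G"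
  by (rule chart_carrier[OF chart_one_atlas chart_inv_in[OF chart_one_atlas]])

text \<open>Only germs at \<open>0\<close> are considered, so that curves may be modified away from \<open>0\<close>.\<close>

definition tangent :: "(real \<Rightarrow> 'g) \<Rightarrow> 'e \<Rightarrow> bool" where
  "tangent a X \<longleftrightarrow> a 0 = \<one> \<and> eventually (\<lambda>s. a s \<in> U1) (nhds 0) \<and>
     ((\<lambda>s. co (a s)) has_vector_derivative X) (at 0)"

lemma tangent_velocity: "tangent a X \<Longrightarrow> velocity G a = X"
  unfolding tangent_def velocity_def by (elim conjE) (rule vector_derivative_at)

lemma tangent_unique: "tangent a X \<Longrightarrow> tangent a Y \<Longrightarrow> X = Y"
  using tangent_velocity[of a X] tangent_velocity[of a Y] by simp

lemma tangent_cong: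
  assumes "tangent a X" and ev: "eventually (\<lambda>s. a s = b s) (nhds 0)"
  shows "tangent b X"
  unfolding tangent_def
proof (intro conjI)
  show "b 0 = \<one>" using eventually_nhds_x_imp_x[OF ev] assms(1) by (simp add: tangent_def)
  have "eventually (\<lambda>s. a s \<in> U1) (nhds 0)" using assms(1) by (simp add: tangent_def)
  with ev show "eventually (\<lambda>s. b s \<in> U1) (nhds 0)" by eventually_elim simp
  have "eventually (\<lambda>s. co (a s) = co (b s)) (nhds 0)" using ev by eventually_elim simp
  moreover have "((\<lambda>s. co (a s)) has_vector_derivative X) (at 0)"
    using assms(1) by (simp add: tangent_def)
  ultimately show "((\<lambda>s. co (b s)) has_vector_derivative X) (at 0)"
    by (rule has_vector_derivative_cong_nhds[rotated])
qed

lemma smooth_tangent: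
  assumes "smooth_into G D a" and "0 \<in> D" and "a 0 = \<one>"
  shows "tangent a (velocity G a)"
proof -
  have "a 0 \<in> U1" using assms(3) one_in_U1 by simp
  then obtain N where N: "open N" "0 \<in> N" "a ` N \<subseteq> U1" "smooth_fun_on N (\<lambda>q. co (a q))"
    using smooth_into_chart[OF assms(1,2) chart_one_atlas] by blast
  have "eventually (\<lambda>s. a s \<in> U1) (nhds 0)"
    unfolding eventually_nhds using N(1-3) by blast
  moreover have "((\<lambda>s. co (a s)) has_vector_derivative velocity G a) (at 0)"
    unfolding velocity_def
    using smooth_fun_on_differentiable[OF N(4,2)] by (simp add: vector_derivative_works)
  ultimately show ?thesis using assms(3) by (simp add: tangent_def)
qed

lemma tangent_line: "tangent (\<lambda>s. coi (e0 + s *\<^sub>R X)) X"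
proof -
  have "isCont (\<lambda>s. e0 + s *\<^sub>R X) 0" by (intro continuous_intros)
  then have ev: "eventually (\<lambda>s. e0 + s *\<^sub>R X \<in> chart_image (chart_one G)) (nhds 0)"
    by (rule eventually_nhds_in_open) (simp_all add: e0_image open_chart_image[OF chart_one_atlas])
  have "((\<lambda>s. e0 + s *\<^sub>R X) has_vector_derivative X) (at 0)"
    by (auto intro!: derivative_eq_intros)
  moreover have "eventually (\<lambda>s. e0 + s *\<^sub>R X = co (coi (e0 + s *\<^sub>R X))) (nhds 0)"
    using ev by eventually_elim (simp add: chart_chart_inv[OF chart_one_atlas])
  ultimately have "((\<lambda>s. co (coi (e0 + s *\<^sub>R X))) has_vector_derivative X) (at 0)"
    by (rule has_vector_derivative_cong_nhds)
  moreover have "eventually (\<lambda>s. coi (e0 + s *\<^sub>R X) \<in> U1) (nhds 0)"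
    using ev by eventually_elim (rule chart_inv_in[OF chart_one_atlas])
  ultimately show ?thesis by (simp add: tangent_def coi_e0)
qed

lemma tangent_coordinates:
  assumes "tangent a X"
  shows "eventually (\<lambda>s. a s = coi (co (a s)) \<and> co (a s) \<in> chart_image (chart_one G)) (nhds 0)"
    and "((\<lambda>s. co (a s)) has_vector_derivative X) (at 0)" and "co (a 0) = e0"
proof -
  have "eventually (\<lambda>s. a s \<in> U1) (nhds 0)" using assms by (simp add: tangent_def)
  then show "eventually (\<lambda>s. a s = coi (co (a s)) \<and> co (a s) \<in> chart_image (chart_one G)) (nhds 0)"
    by eventually_elim
      (simp add: chart_inv_chart[OF chart_one_atlas] chart_in_image[OF chart_one_atlas])
qed (use assms in \<open>simp_all add: tangent_def coord_one_def\<close>)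

lemma differentiable_in_chart_one:
  assumes "smooth_into G D f" and "p \<in> D" and "f p \<in> U1"
  shows "(\<lambda>q. co (f q)) differentiable (at p)" and "eventually (\<lambda>q. f q \<in> U1) (nhds p)"
proof -
  obtain N where N: "open N" "p \<in> N" "f ` N \<subseteq> U1" "smooth_fun_on N (\<lambda>q. co (f q))"
    using smooth_into_chart[OF assms(1,2) chart_one_atlas assms(3)] by blast
  show "(\<lambda>q. co (f q)) differentiable (at p)" by (rule smooth_fun_on_differentiable[OF N(4,2)])
  show "eventually (\<lambda>q. f q \<in> U1) (nhds p)" unfolding eventually_nhds using N by blast
qed

lemma eventually_compose_curve:
  assumes "(\<gamma> has_vector_derivative v) (at 0)" and "eventually P (nhds (\<gamma> 0))"
  shows "eventually (\<lambda>s. P (\<gamma> s)) (nhds 0)"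
proof -
  obtain S where S: "open S" "\<gamma> 0 \<in> S" "\<And>y. y \<in> S \<Longrightarrow> P y"
    using assms(2) unfolding eventually_nhds by blast
  have "eventually (\<lambda>s. \<gamma> s \<in> S) (nhds 0)"
    by (rule eventually_nhds_in_open[OF has_vector_derivative_continuous[OF assms(1)] S(1,2)])
  then show ?thesis by eventually_elim (rule S(3))
qed

lemma diff_one_linear_and_tangent:
  assumes s: "smooth_self_map G s" and "s \<one> = \<one>"
  shows "linear (diff_one G s)" and "tangent a X \<Longrightarrow> tangent (\<lambda>t. s (a t)) (diff_one G s X)"
proof -
  let ?f = "\<lambda>u. s (coi u)"
  have sm: "smooth_into G (chart_image (chart_one G)) ?f"
    using s chart_one_atlas by (simp add: smooth_self_map_def o_def)
  have f1: "?f e0 \<in> U1" using one_in_U1 by (simp add: coi_e0 assms(2))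
  note d = differentiable_in_chart_one[OF sm e0_image f1]
  have eq: "diff_one G s = frechet_derivative (\<lambda>u. co (?f u)) (at e0)"
    by (simp add: diff_one_def o_def)
  show "linear (diff_one G s)" unfolding eq by (rule linear_frechet_derivative[OF d(1)])
  assume a: "tangent a X"
  note c = tangent_coordinates[OF a]
  have "eventually (\<lambda>t. ?f (co (a t)) \<in> U1) (nhds 0)"
    by (rule eventually_compose_curve[OF c(2)]) (simp add: c(3) d(2))
  moreover have "((\<lambda>t. co (?f (co (a t)))) has_vector_derivative diff_one G s X) (at 0)"
    unfolding eq using vector_chain[OF c(2), of "\<lambda>u. co (?f u)"] d(1) by (simp add: c(3))
  ultimately have "tangent (\<lambda>t. ?f (co (a t))) (diff_one G s X)"
    by (simp add: tangent_def c(3) coi_e0 assms(2))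
  then show "tangent (\<lambda>t. s (a t)) (diff_one G s X)"
    by (rule tangent_cong) (use c(1) in \<open>eventually_elim, simp\<close>)
qed

definition mu :: "'e \<times> 'e \<Rightarrow> 'e" where
  "mu w = co (coi (fst w) \<otimes> coi (snd w))"

text \<open>A neighbourhood on which \<open>mu\<close> is smooth and does describe the multiplication. Elsewhere a product may
  leave the chart, and then the value of \<open>mu\<close> is arbitrary.\<close>

definition mu_dom :: "('e \<times> 'e) set" where
  "mu_dom = (SOME N. open N \<and> (e0, e0) \<in> N \<and>
     N \<subseteq> chart_image (chart_one G) \<times> chart_image (chart_one G) \<and>
     (\<lambda>w. coi (fst w) \<otimes> coi (snd w)) ` N \<subseteq> U1 \<and> smooth_fun_on N mu)"

lemma mu_dom:
  "open mu_dom" "(e0, e0) \<in> mu_dom" "smooth_fun_on mu_dom mu"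
  "w \<in> mu_dom \<Longrightarrow> fst w \<in> chart_image (chart_one G)"
  "w \<in> mu_dom \<Longrightarrow> snd w \<in> chart_image (chart_one G)"
  "w \<in> mu_dom \<Longrightarrow> coi (fst w) \<otimes> coi (snd w) \<in> U1"
proof -
  let ?f = "\<lambda>w. coi (fst w) \<otimes> coi (snd w)"
  have "smooth_into G (chart_image (chart_one G) \<times> chart_image (chart_one G)) ?f"
    using lie_group chart_one_atlas by (simp add: lie_group_def case_prod_unfold)
  moreover have "(e0, e0) \<in> chart_image (chart_one G) \<times> chart_image (chart_one G)"
    using e0_image by simp
  moreover have "?f (e0, e0) \<in> U1" by (simp add: coi_e0 one_in_U1)
  ultimately have "\<exists>N. open N \<and> (e0, e0) \<in> N \<and>
     N \<subseteq> chart_image (chart_one G) \<times> chart_image (chart_one G) \<and> ?f ` N \<subseteq> U1 \<and>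
     smooth_fun_on N (\<lambda>w. co (?f w))"
    by (rule smooth_into_chart[OF _ _ chart_one_atlas])
  then have "\<exists>N. open N \<and> (e0, e0) \<in> N \<and>
     N \<subseteq> chart_image (chart_one G) \<times> chart_image (chart_one G) \<and> ?f ` N \<subseteq> U1 \<and>
     smooth_fun_on N mu"
    by (simp add: mu_def[abs_def])
  from someI_ex[OF this] have N: "open mu_dom \<and> (e0, e0) \<in> mu_dom \<and>
     mu_dom \<subseteq> chart_image (chart_one G) \<times> chart_image (chart_one G) \<and> ?f ` mu_dom \<subseteq> U1 \<and>
     smooth_fun_on mu_dom mu"
    unfolding mu_dom_def .
  show "open mu_dom" "(e0, e0) \<in> mu_dom" "smooth_fun_on mu_dom mu" using N by simp_all
  assume w: "w \<in> mu_dom"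
  with N have "w \<in> chart_image (chart_one G) \<times> chart_image (chart_one G)" "?f w \<in> U1" by blast+
  then show "fst w \<in> chart_image (chart_one G)" "snd w \<in> chart_image (chart_one G)"
    "coi (fst w) \<otimes> coi (snd w) \<in> U1"
    by (simp_all add: mem_Times_iff)
qed

lemma mu_right_one: "u \<in> chart_image (chart_one G) \<Longrightarrow> mu (u, e0) = u"
  by (simp add: mu_def coi_e0 coi_carrier chart_chart_inv[OF chart_one_atlas])

lemma mu_left_one: "u \<in> chart_image (chart_one G) \<Longrightarrow> mu (e0, u) = u"
  by (simp add: mu_def coi_e0 coi_carrier chart_chart_inv[OF chart_one_atlas])

lemma mu_differentiable: "w \<in> mu_dom \<Longrightarrow> mu differentiable (at w)"
  by (rule smooth_fun_on_differentiable[OF mu_dom(3)])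

text \<open>As \<open>mu (u, e0) = u\<close> and \<open>mu (e0, v) = v\<close>, the derivative of the multiplication at the identity
  is the addition of tangent vectors.\<close>

lemma mu_derivative_one: "frechet_derivative mu (at (e0, e0)) (X, Y) = X + Y"
proof -
  let ?L = "frechet_derivative mu (at (e0, e0))"
  have d: "mu differentiable (at (e0, e0))" by (rule mu_differentiable[OF mu_dom(2)])
  have one: "?L w = v"
    if w: "\<And>s. e0 + s *\<^sub>R v \<in> chart_image (chart_one G) \<Longrightarrow> mu ((e0, e0) + s *\<^sub>R w) = e0 + s *\<^sub>R v"
    for v w
  proof -
    have "((\<lambda>s. mu ((e0, e0) + s *\<^sub>R w)) has_vector_derivative ?L w) (at 0)"
      by (rule directional_derivative[OF d])
    moreover have "isCont (\<lambda>s. e0 + s *\<^sub>R v) 0" by (intro continuous_intros)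
    then have "eventually (\<lambda>s. e0 + s *\<^sub>R v \<in> chart_image (chart_one G)) (nhds 0)"
      by (rule eventually_nhds_in_open) (simp_all add: e0_image open_chart_image[OF chart_one_atlas])
    then have "eventually (\<lambda>s. mu ((e0, e0) + s *\<^sub>R w) = e0 + s *\<^sub>R v) (nhds 0)"
      by eventually_elim (rule w)
    ultimately have "((\<lambda>s. e0 + s *\<^sub>R v) has_vector_derivative ?L w) (at 0)"
      by (rule has_vector_derivative_cong_nhds)
    moreover have "((\<lambda>s. e0 + s *\<^sub>R v) has_vector_derivative v) (at 0)"
      by (auto intro!: derivative_eq_intros)
    ultimately show ?thesis by (rule vector_derivative_unique_at)
  qed
  have "?L (X, Y) = ?L (X, 0) + ?L (0, Y)"
    using linear_add[OF linear_frechet_derivative[OF d], of "(X, 0)" "(0, Y)"] by simp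
  also have "?L (X, 0) = X" by (rule one) (simp add: mu_right_one)
  also have "?L (0, Y) = Y" by (rule one) (simp add: mu_left_one)
  finally show ?thesis .
qed

lemma tangent_mult:
  assumes a: "tangent a X" and b: "tangent b Y"
  shows "tangent (\<lambda>s. a s \<otimes> b s) (X + Y)"
proof -
  note ca = tangent_coordinates[OF a] and cb = tangent_coordinates[OF b]
  let ?\<gamma> = "\<lambda>s. (co (a s), co (b s))"
  have g: "(?\<gamma> has_vector_derivative (X, Y)) (at 0)"
    by (rule has_vector_derivative_Pair[OF ca(2) cb(2)])
  have g0: "?\<gamma> 0 = (e0, e0)" by (simp add: ca(3) cb(3))
  have "isCont ?\<gamma> 0" by (rule has_vector_derivative_continuous[OF g])
  then have ev: "eventually (\<lambda>s. ?\<gamma> s \<in> mu_dom) (nhds 0)"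
    by (rule eventually_nhds_in_open[OF _ mu_dom(1)]) (simp add: g0 mu_dom(2))
  have "((\<lambda>s. mu (?\<gamma> s)) has_vector_derivative X + Y) (at 0)"
    using vector_chain[OF g, of mu] mu_differentiable[OF mu_dom(2)]
    by (simp add: ca(3) cb(3) mu_derivative_one)
  moreover have "eventually (\<lambda>s. coi (fst (?\<gamma> s)) \<otimes> coi (snd (?\<gamma> s)) \<in> U1) (nhds 0)"
    using ev by eventually_elim (rule mu_dom(6))
  ultimately have "tangent (\<lambda>s. coi (co (a s)) \<otimes> coi (co (b s))) (X + Y)"
    by (simp add: tangent_def ca(3) cb(3) coi_e0 mu_def)
  then show ?thesis
    by (rule tangent_cong) (use ca(1) cb(1) in \<open>eventually_elim, simp\<close>)
qed

lemma Ad_tangent_and_linear: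
  assumes g: "g \<in> carrier G"
  shows "linear (Ad G g)" and "tangent a X \<Longrightarrow> tangent (\<lambda>s. g \<otimes> a s \<otimes> inv g) (Ad G g X)"
proof -
  have "smooth_self_map G (\<lambda>x. g \<otimes> x \<otimes> inv g)"
    unfolding smooth_self_map_def
  proof
    fix c assume c: "c \<in> atlas G"
    have "smooth_into G (chart_image c) (\<lambda>u. g \<otimes> chart_inv c u \<otimes> inv g)"
      by (intro smooth_into_mult smooth_into_const smooth_into_chart_inv open_chart_image c inv_closed g)
    then show "smooth_into G (chart_image c) ((\<lambda>x. g \<otimes> x \<otimes> inv g) \<circ> chart_inv c)"
      by (simp add: o_def)
  qed
  note d = diff_one_linear_and_tangent[OF this]
  show "linear (Ad G g)" unfolding Ad_def by (rule d(1)) (simp add: g)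
  show "tangent (\<lambda>s. g \<otimes> a s \<otimes> inv g) (Ad G g X)" if "tangent a X"
    unfolding Ad_def by (rule d(2)[OF _ that]) (simp add: g)
qed

lemma tangent_carrier:
  assumes "tangent a X" shows "eventually (\<lambda>s. a s \<in> carrier G) (nhds 0)"
proof -
  have "eventually (\<lambda>s. a s \<in> U1) (nhds 0)" using assms by (simp add: tangent_def)
  then show ?thesis by eventually_elim (rule chart_carrier[OF chart_one_atlas])
qed

lemma Ad_inj:
  assumes g: "g \<in> carrier G" and eq: "Ad G g X = Ad G g Y"
  shows "X = Y"
proof -
  have "Ad G (inv g) (Ad G g Z) = Z" for Z
  proof -
    let ?a = "\<lambda>s. coi (e0 + s *\<^sub>R Z)"
    have "tangent (\<lambda>s. inv g \<otimes> (g \<otimes> ?a s \<otimes> inv g) \<otimes> inv (inv g)) (Ad G (inv g) (Ad G g Z))"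
      by (intro Ad_tangent_and_linear tangent_line g inv_closed)
    then have "tangent ?a (Ad G (inv g) (Ad G g Z))"
    proof (rule tangent_cong)
      show "eventually (\<lambda>s. inv g \<otimes> (g \<otimes> ?a s \<otimes> inv g) \<otimes> inv (inv g) = ?a s) (nhds 0)"
        using tangent_carrier[OF tangent_line[of Z]]
      proof eventually_elim
        case (elim s)
        then show ?case using g by (simp add: m_assoc[symmetric]) (simp add: m_assoc)
      qed
    qed
    then show ?thesis by (rule tangent_unique[OF _ tangent_line])
  qed
  with eq show ?thesis by metis
qed

lemma darboux_tangent:
  assumes D: "open D" "p \<in> D" and f: "smooth_into G D f"
  shows "tangent (\<lambda>s. inv (f p) \<otimes> f (p + s *\<^sub>R v)) (darboux G f p v)"
  unfolding darboux_def
proof (rule smooth_tangent)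
  let ?D = "{s. p + s *\<^sub>R v \<in> D}"
  have o: "open ?D" by (rule open_line_preimage[OF D(1)])
  have fp: "f p \<in> carrier G" by (rule smooth_into_carrier[OF f D(2)])
  have "smooth_into G ?D (\<lambda>s. f (p + s *\<^sub>R v))"
    by (rule smooth_into_compose[OF o smooth_fun_on_line[OF o] _ f]) auto
  then show "smooth_into G ?D (\<lambda>s. inv (f p) \<otimes> f (p + s *\<^sub>R v))"
    by (intro smooth_into_mult o smooth_into_const inv_closed fp)
  show "0 \<in> ?D" "inv (f p) \<otimes> f (p + 0 *\<^sub>R v) = \<one>" using D(2) fp by simp_all
qed

lemma eventually_line_in:
  fixes p v :: "'a::real_normed_vector"
  assumes "open D" "p \<in> D" shows "eventually (\<lambda>s. p + s *\<^sub>R v \<in> D) (nhds (0::real))"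
proof -
  have "isCont (\<lambda>s. p + s *\<^sub>R v) 0" by (intro continuous_intros)
  then show ?thesis by (rule eventually_nhds_in_open) (use assms in simp_all)
qed

lemma darboux_left_translate:
  assumes D: "open D" "p \<in> D" and f: "smooth_into G D f" and g: "g \<in> carrier G"
  shows "darboux G (\<lambda>q. g \<otimes> f q) p v = darboux G f p v"
proof -
  have "smooth_into G D (\<lambda>q. g \<otimes> f q)"
    by (intro smooth_into_mult D f smooth_into_const g)
  note t = darboux_tangent[OF D this, of v]
  have fp: "f p \<in> carrier G" by (rule smooth_into_carrier[OF f D(2)])
  have "tangent (\<lambda>s. inv (f p) \<otimes> f (p + s *\<^sub>R v)) (darboux G (\<lambda>q. g \<otimes> f q) p v)"
  proof (rule tangent_cong[OF t])
    show "eventually (\<lambda>s. inv (g \<otimes> f p) \<otimes> (g \<otimes> f (p + s *\<^sub>R v)) = inv (f p) \<otimes> f (p + s *\<^sub>R v)) (nhds 0)"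
      using eventually_line_in[OF D, of v]
    proof eventually_elim
      case (elim s)
      then have "f (p + s *\<^sub>R v) \<in> carrier G" by (rule smooth_into_carrier[OF f])
      then show ?case using g fp by (simp add: inv_mult_group m_assoc[symmetric]) (simp add: m_assoc)
    qed
  qed
  then show ?thesis by (rule tangent_unique[OF _ darboux_tangent[OF D f]])
qed

text \<open>The curve \<open>(fg (p))\<inverse> fg (p + sv)\<close> is the product of the conjugate of \<open>f (p)\<inverse> f (p + sv)\<close> by
  \<open>g (p)\<inverse>\<close> with \<open>g (p)\<inverse> g (p + sv)\<close>.\<close>

lemma darboux_mult:
  assumes D: "open D" "p \<in> D" and f: "smooth_into G D f" and g: "smooth_into G D g"
  shows "darboux G (\<lambda>q. f q \<otimes> g q) p v = Ad G (inv (g p)) (darboux G f p v) + darboux G g p v"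
proof -
  have fp: "f p \<in> carrier G" and gp: "g p \<in> carrier G"
    using smooth_into_carrier[OF f D(2)] smooth_into_carrier[OF g D(2)] .
  have "tangent (\<lambda>s. (inv (g p) \<otimes> (inv (f p) \<otimes> f (p + s *\<^sub>R v)) \<otimes> inv (inv (g p)))
      \<otimes> (inv (g p) \<otimes> g (p + s *\<^sub>R v))) (Ad G (inv (g p)) (darboux G f p v) + darboux G g p v)"
    by (intro tangent_mult Ad_tangent_and_linear darboux_tangent[OF D f] darboux_tangent[OF D g]
        inv_closed gp)
  then have "tangent (\<lambda>s. inv (f p \<otimes> g p) \<otimes> (f (p + s *\<^sub>R v) \<otimes> g (p + s *\<^sub>R v)))
      (Ad G (inv (g p)) (darboux G f p v) + darboux G g p v)"
  proof (rule tangent_cong)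
    show "eventually (\<lambda>s. inv (g p) \<otimes> (inv (f p) \<otimes> f (p + s *\<^sub>R v)) \<otimes> inv (inv (g p))
      \<otimes> (inv (g p) \<otimes> g (p + s *\<^sub>R v)) = inv (f p \<otimes> g p) \<otimes> (f (p + s *\<^sub>R v) \<otimes> g (p + s *\<^sub>R v))) (nhds 0)"
      using eventually_line_in[OF D, of v]
    proof eventually_elim
      case (elim s)
      then have fs: "f (p + s *\<^sub>R v) \<in> carrier G" and gs: "g (p + s *\<^sub>R v) \<in> carrier G"
        using smooth_into_carrier[OF f] smooth_into_carrier[OF g] by blast+
      have "inv (inv (g p)) \<otimes> (inv (g p) \<otimes> g (p + s *\<^sub>R v)) = g (p + s *\<^sub>R v)"
        using gp gs by (simp add: m_assoc[symmetric])
      then show ?case using fp gp fs gs by (simp add: inv_mult_group m_assoc)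
    qed
  qed
  moreover have "smooth_into G D (\<lambda>q. f q \<otimes> g q)" by (intro smooth_into_mult D f g)
  ultimately show ?thesis using tangent_unique[OF darboux_tangent[OF D, of "\<lambda>q. f q \<otimes> g q"]] by blast
qed

text \<open>Since \<open>f (q + sv) = f q \<otimes> b s\<close> with \<open>b\<close> tangent to the logarithmic derivative, ordinary and
  logarithmic derivative determine each other through the partial derivative of the multiplication
  in its second argument.\<close>

lemma chart_derivative_darboux:
  assumes D: "open D" "q \<in> D" and f: "smooth_into G D f" and q: "f q \<in> U1" "(co (f q), e0) \<in> mu_dom"
  shows "((\<lambda>s. co (f (q + s *\<^sub>R v))) has_vector_derivative
    frechet_derivative mu (at (co (f q), e0)) (0, darboux G f q v)) (at 0)"
proof -
  let ?b = "\<lambda>s. inv (f q) \<otimes> f (q + s *\<^sub>R v)"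
  note c = tangent_coordinates[OF darboux_tangent[OF D f, of v]]
  have g: "((\<lambda>s. (co (f q), co (?b s))) has_vector_derivative (0, darboux G f q v)) (at 0)"
    by (rule has_vector_derivative_Pair[OF has_vector_derivative_const c(2)])
  have "((\<lambda>s. mu (co (f q), co (?b s))) has_vector_derivative
    frechet_derivative mu (at (co (f q), e0)) (0, darboux G f q v)) (at 0)"
    using vector_chain[OF g, of mu, unfolded c(3)] mu_differentiable[OF q(2)] by simp
  moreover have "eventually (\<lambda>s. mu (co (f q), co (?b s)) = co (f (q + s *\<^sub>R v))) (nhds 0)"
    using c(1) eventually_line_in[OF D, of v]
  proof eventually_elim
    case (elim s)
    have "f q \<in> carrier G" "f (q + s *\<^sub>R v) \<in> carrier G"
      using smooth_into_carrier[OF f] D(2) elim(2) by blast+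
    then have "f q \<otimes> ?b s = f (q + s *\<^sub>R v)" by (simp add: m_assoc[symmetric])
    with elim(1) show ?case
      by (simp add: mu_def chart_inv_chart[OF chart_one_atlas q(1)])
  qed
  ultimately show ?thesis by (rule has_vector_derivative_cong_nhds)
qed

text \<open>After a left translation the value at \<open>p\<close> may be taken to be the identity; near \<open>p\<close> the coordinates of
  the map then have derivative zero, by \<open>chart_derivative_darboux\<close>.\<close>

lemma darboux_zero_imp_constant:
  assumes D: "open D" "connected D" and f: "smooth_into G D f"
    and z: "\<And>p v. p \<in> D \<Longrightarrow> darboux G f p v = 0" and "p \<in> D" "q \<in> D"
  shows "f p = f q"
proof (rule connected_local_const[OF D(2) assms(5,6)], intro ballI)
  fix p assume p: "p \<in> D"
  have fp: "f p \<in> carrier G" by (rule smooth_into_carrier[OF f p])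
  let ?w = "\<lambda>x. inv (f p) \<otimes> f x"
  have w: "smooth_into G D ?w"
    by (intro smooth_into_mult D f smooth_into_const inv_closed fp)
  have w1: "?w p = \<one>" using fp by simp
  then have "?w p \<in> U1" using one_in_U1 by simp
  then obtain N where N: "open N" "p \<in> N" "N \<subseteq> D" "?w ` N \<subseteq> U1" "smooth_fun_on N (\<lambda>x. co (?w x))"
    using smooth_into_chart[OF w p chart_one_atlas] by blast
  have "isCont (\<lambda>x. (co (?w x), e0)) p"
    by (intro continuous_intros differentiable_imp_continuous_within
        smooth_fun_on_differentiable[OF N(5,2)])
  then have "eventually (\<lambda>x. (co (?w x), e0) \<in> mu_dom) (nhds p)"
    by (rule eventually_nhds_in_open[OF _ mu_dom(1)]) (simp add: w1 mu_dom(2)[unfolded coord_one_def] coord_one_def)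
  then obtain S where S: "open S" "p \<in> S" "\<And>x. x \<in> S \<Longrightarrow> (co (?w x), e0) \<in> mu_dom"
    unfolding eventually_nhds by blast
  have "open (N \<inter> S)" "p \<in> N \<inter> S" using N S by auto
  then obtain r where r: "r > 0" "ball p r \<subseteq> N \<inter> S" unfolding open_contains_ball by blast
  have der: "((\<lambda>x. co (?w x)) has_derivative (\<lambda>v. 0)) (at x)" if x: "x \<in> ball p r" for x
  proof -
    have xN: "x \<in> N" and xS: "x \<in> S" and xD: "x \<in> D" using x r N(3) by blast+
    have wU: "?w x \<in> U1" using N(4) xN by blast
    have d: "(\<lambda>x. co (?w x)) differentiable (at x)" by (rule smooth_fun_on_differentiable[OF N(5) xN])
    have "frechet_derivative (\<lambda>x. co (?w x)) (at x) v = 0" for v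
    proof -
      have "darboux G ?w x v = 0"
        using darboux_left_translate[OF D(1) xD f inv_closed[OF fp], of v] z[OF xD] by simp
      then have "((\<lambda>s. co (?w (x + s *\<^sub>R v))) has_vector_derivative
          frechet_derivative mu (at (co (?w x), e0)) (0, 0)) (at 0)"
        using chart_derivative_darboux[OF D(1) xD w wU S(3)[OF xS], of v] by simp
      moreover have "frechet_derivative mu (at (co (?w x), e0)) (0, 0) = 0"
        using linear_0[OF linear_frechet_derivative[OF mu_differentiable[OF S(3)[OF xS]]]]
        by (simp add: zero_prod_def)
      ultimately show ?thesis
        using vector_derivative_unique_at[OF directional_derivative[OF d]] by metis
    qed
    then have "frechet_derivative (\<lambda>x. co (?w x)) (at x) = (\<lambda>v. 0)" by (rule ext)
    then show ?thesis using d by (simp add: frechet_derivative_works)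
  qed
  have "f p = f x" if x: "x \<in> ball p r" for x
  proof -
    have "co (?w x) = co (?w p)"
      by (rule has_derivative_zero_unique_connected[OF open_ball connected_ball der x])
        (use r in simp_all)
    moreover have "?w x \<in> U1" using N(4) r x by blast
    ultimately have "?w x = \<one>"
      using chart_inj[OF chart_one_atlas] one_in_U1 by (simp add: w1 inj_on_eq_iff)
    moreover have fx: "f x \<in> carrier G" using smooth_into_carrier[OF f] N(3) r x by blast
    ultimately have "inv (f x) = inv (f p)" using fp by (intro inv_equality) simp_all
    then have "inv (inv (f x)) = inv (inv (f p))" by (rule arg_cong)
    then show ?thesis using fp fx by simp
  qed
  then have "eventually (\<lambda>x. f p = f x) (nhds p)"
    unfolding eventually_nhds using r(1) by (intro exI[of _ "ball p r"]) simp
  then show "eventually (\<lambda>x. f p = f x) (at p within D)"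
    by (simp add: eventually_at_filter eventually_mono)
qed

text \<open>For \<open>W = V U\<inverse>\<close>, the product rule applied to \<open>V = W U\<close> gives
  \<open>Ad (U\<inverse>) (W\<inverse> dW) = 0\<close>.\<close>

lemma darboux_eq_imp_left_translate:
  assumes D: "open D" "connected D" and U: "smooth_into G D U" and V: "smooth_into G D V"
    and eq: "\<And>p v. p \<in> D \<Longrightarrow> darboux G U p v = darboux G V p v" and "p \<in> D" "q \<in> D"
  shows "V p \<otimes> inv (U p) = V q \<otimes> inv (U q)"
proof (rule darboux_zero_imp_constant[OF D _ _ assms(6,7)])
  let ?W = "\<lambda>p. V p \<otimes> inv (U p)"
  show W: "smooth_into G D ?W" by (intro smooth_into_mult smooth_into_inv D U V)
  fix p v assume p: "p \<in> D"
  have WU: "?W q \<otimes> U q = V q" if "q \<in> D" for q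
    using smooth_into_carrier[OF U that] smooth_into_carrier[OF V that] by (simp add: m_assoc)
  have cp: "U p \<in> carrier G" by (rule smooth_into_carrier[OF U p])
  have sm: "smooth_into G D (\<lambda>q. ?W q \<otimes> U q)" by (intro smooth_into_mult D W U)
  have "tangent (\<lambda>s. inv (V p) \<otimes> V (p + s *\<^sub>R v)) (darboux G (\<lambda>q. ?W q \<otimes> U q) p v)"
  proof (rule tangent_cong[OF darboux_tangent[OF D(1) p sm]])
    show "eventually (\<lambda>s. inv (?W p \<otimes> U p) \<otimes> (?W (p + s *\<^sub>R v) \<otimes> U (p + s *\<^sub>R v))
        = inv (V p) \<otimes> V (p + s *\<^sub>R v)) (nhds 0)"
      using eventually_line_in[OF D(1) p, of v] by eventually_elim (simp add: WU p)
  qed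
  then have "darboux G (\<lambda>q. ?W q \<otimes> U q) p v = darboux G V p v"
    by (rule tangent_unique[OF _ darboux_tangent[OF D(1) p V]])
  then have "Ad G (inv (U p)) (darboux G ?W p v) + darboux G U p v = darboux G V p v"
    using darboux_mult[OF D(1) p W U, of v] by simp
  then have "Ad G (inv (U p)) (darboux G ?W p v) = 0" using eq[OF p] by simp
  also have "0 = Ad G (inv (U p)) 0"
    using linear_0[OF Ad_tangent_and_linear(1)[OF inv_closed[OF cp]]] by simp
  finally show "darboux G ?W p v = 0" by (rule Ad_inj[OF inv_closed[OF cp]])
qed

end

section \<open>One-parameter subgroups and the exponential map\<close>

context lie_grp
begin

text \<open>Left translation by \<open>coi u\<close> has an inverse, hence so has its differential at the
  identity.\<close>

lemma mu_partial_left_inverse: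
  assumes u: "(u, e0) \<in> mu_dom"
  shows "\<exists>M. \<forall>X. M (frechet_derivative mu (at (u, e0)) (0, X)) = X"
proof -
  let ?f = "\<lambda>x. inv (coi u) \<otimes> coi x"
  let ?M = "frechet_derivative (\<lambda>x. co (?f x)) (at u)"
  have uc: "u \<in> chart_image (chart_one G)" using mu_dom(4)[OF u] by simp
  have g: "coi u \<in> carrier G" by (rule coi_carrier[OF uc])
  have f: "smooth_into G (chart_image (chart_one G)) ?f"
    by (intro smooth_into_mult smooth_into_const smooth_into_chart_inv
        open_chart_image[OF chart_one_atlas] chart_one_atlas inv_closed g)
  have "?f u \<in> U1" using g one_in_U1 by simp
  note d = differentiable_in_chart_one(1)[OF f uc this]
  have "?M (frechet_derivative mu (at (u, e0)) (0, X)) = X" for X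
  proof -
    let ?c = "\<lambda>s. mu (u, e0 + s *\<^sub>R X)"
    have line: "((\<lambda>s. (u, e0 + s *\<^sub>R X)) has_vector_derivative (0, X)) (at 0)"
      by (auto intro!: derivative_eq_intros)
    have c: "(?c has_vector_derivative frechet_derivative mu (at (u, e0)) (0, X)) (at 0)"
      using vector_chain[OF line, of mu] mu_differentiable[OF u] by simp
    have "((\<lambda>s. co (?f (?c s))) has_vector_derivative
        ?M (frechet_derivative mu (at (u, e0)) (0, X))) (at 0)"
      using vector_chain[OF c, of "\<lambda>x. co (?f x)"] d by (simp add: mu_right_one uc)
    moreover have "eventually (\<lambda>s. co (?f (?c s)) = e0 + s *\<^sub>R X) (nhds 0)"
    proof -
      have "isCont (\<lambda>s. (u, e0 + s *\<^sub>R X)) 0" by (intro continuous_intros)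
      then have "eventually (\<lambda>s. (u, e0 + s *\<^sub>R X) \<in> mu_dom) (nhds 0)"
        by (rule eventually_nhds_in_open) (simp_all add: u mu_dom(1))
      then show ?thesis
      proof eventually_elim
        case (elim s)
        then have v: "e0 + s *\<^sub>R X \<in> chart_image (chart_one G)"
          and U: "coi u \<otimes> coi (e0 + s *\<^sub>R X) \<in> U1"
          using mu_dom(5)[OF elim] mu_dom(6)[OF elim] by simp_all
        have "coi (?c s) = coi u \<otimes> coi (e0 + s *\<^sub>R X)"
          by (simp add: mu_def chart_inv_chart[OF chart_one_atlas U])
        then have "?f (?c s) = coi (e0 + s *\<^sub>R X)"
          using g coi_carrier[OF v] by (simp add: m_assoc[symmetric])
        then show ?case by (simp add: chart_chart_inv[OF chart_one_atlas v])
      qed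
    qed
    ultimately have "((\<lambda>s. e0 + s *\<^sub>R X) has_vector_derivative
        ?M (frechet_derivative mu (at (u, e0)) (0, X))) (at 0)"
      by (rule has_vector_derivative_cong_nhds)
    moreover have "((\<lambda>s. e0 + s *\<^sub>R X) has_vector_derivative X) (at 0)"
      by (auto intro!: derivative_eq_intros)
    ultimately show ?thesis by (rule vector_derivative_unique_at)
  qed
  then show ?thesis by blast
qed

text \<open>The left-invariant vector field with value \<open>X\<close> at the identity is
  \<open>u \<mapsto> D mu (u, e0) (0, X)\<close> in coordinates.\<close>

lemma local_integral_curve:
  "\<exists>e>0. \<exists>a. smooth_into G {-e<..<e} a \<and> a 0 = \<one> \<and>
     (\<forall>t\<in>{-e<..<e}. \<forall>v. darboux G a t v = v *\<^sub>R X)"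
proof -
  let ?f = "\<lambda>u. frechet_derivative mu (at (u, e0)) (0, X)"
  let ?V = "{u. (u, e0) \<in> mu_dom}"
  have V: "open ?V"
  proof -
    have "open ((\<lambda>u. (u, e0)) -` mu_dom)"
      by (rule open_vimage[OF mu_dom(1)]) (intro continuous_intros)
    then show ?thesis by (simp add: vimage_def)
  qed
  have f: "smooth_fun_on ?V ?f"
    by (rule smooth_fun_on_compose[OF V mu_dom(1) _ _ smooth_fun_on_derivative[OF mu_dom(3)]])
      (auto intro: smooth_fun_on_Pair[OF V smooth_fun_on_id smooth_fun_on_const])
  have Vc: "?V \<subseteq> chart_image (chart_one G)"
  proof
    fix u assume "u \<in> ?V"
    then show "u \<in> chart_image (chart_one G)" using mu_dom(4)[of "(u, e0)"] by simp
  qed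
  have "e0 \<in> ?V" by (simp add: mu_dom(2))
  from autonomous_ode_local_solution[OF V f this]
  obtain e u where e: "e > 0" and u: "u 0 = e0" "u ` {-e<..<e} \<subseteq> ?V"
    "smooth_fun_on {-e<..<e} u" "\<And>t. t \<in> {-e<..<e} \<Longrightarrow> (u has_vector_derivative ?f (u t)) (at t)"
    by blast
  let ?I = "{-e<..<e}" and ?a = "\<lambda>t. coi (u t)"
  have uc: "u t \<in> chart_image (chart_one G)" if "t \<in> ?I" for t using u(2) Vc that by blast
  have a: "smooth_into G ?I ?a"
    by (rule smooth_into_compose[OF _ u(3) _ smooth_into_chart_inv[OF chart_one_atlas]])
      (use uc in auto)
  have "darboux G ?a t v = v *\<^sub>R X" if t: "t \<in> ?I" for t v
  proof -
    have ut: "(u t, e0) \<in> mu_dom" using u(2) t by blast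
    have co_a: "co (?a r) = u r" if "r \<in> ?I" for r
      by (rule chart_chart_inv[OF chart_one_atlas uc[OF that]])
    have "((\<lambda>s. co (?a (t + s *\<^sub>R v))) has_vector_derivative
        frechet_derivative mu (at (u t, e0)) (0, darboux G ?a t v)) (at 0)"
      using chart_derivative_darboux[OF _ t a chart_inv_in[OF chart_one_atlas uc[OF t]], of v] ut
      by (simp add: co_a[OF t])
    moreover have "eventually (\<lambda>s. co (?a (t + s *\<^sub>R v)) = u (t + s *\<^sub>R v)) (nhds 0)"
      using eventually_line_in[OF open_greaterThanLessThan t, of v] by eventually_elim (rule co_a)
    ultimately have "((\<lambda>s. u (t + s *\<^sub>R v)) has_vector_derivative
        frechet_derivative mu (at (u t, e0)) (0, darboux G ?a t v)) (at 0)"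
      by (rule has_vector_derivative_cong_nhds)
    moreover have "((\<lambda>s. u (t + s *\<^sub>R v)) has_vector_derivative
        frechet_derivative mu (at (u t, e0)) (0, v *\<^sub>R X)) (at 0)"
    proof -
      have "((\<lambda>s. t + s *\<^sub>R v) has_vector_derivative v) (at 0)"
        by (auto intro!: derivative_eq_intros)
      then have "(u \<circ> (\<lambda>s. t + s *\<^sub>R v) has_vector_derivative v *\<^sub>R ?f (u t)) (at 0)"
        by (rule vector_diff_chain_at) (simp add: u(4)[OF t])
      moreover have "v *\<^sub>R ?f (u t) = frechet_derivative mu (at (u t, e0)) (v *\<^sub>R (0, X))"
        by (rule linear_cmul[OF linear_frechet_derivative[OF mu_differentiable[OF ut]], symmetric])
      ultimately show ?thesis by (simp add: o_def)
    qed
    ultimately have "frechet_derivative mu (at (u t, e0)) (0, darboux G ?a t v)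
        = frechet_derivative mu (at (u t, e0)) (0, v *\<^sub>R X)"
      by (rule vector_derivative_unique_at)
    moreover obtain M where "\<And>X. M (frechet_derivative mu (at (u t, e0)) (0, X)) = X"
      using mu_partial_left_inverse[OF ut] by blast
    ultimately show ?thesis by metis
  qed
  then show ?thesis using e a u(1) coi_e0 by (intro exI[of _ e] conjI exI[of _ ?a]) simp_all
qed

lemma darboux_shift: "darboux G (\<lambda>q. f (q + t)) p v = darboux G f (p + t) v"
  by (simp add: darboux_def add.assoc add.commute[of _ t])

lemma smooth_into_shift:
  assumes "smooth_into G D f" and "open D'" and "\<And>q. q \<in> D' \<Longrightarrow> q + t \<in> D"
  shows "smooth_into G D' (\<lambda>q. f (q + t))"
proof (rule smooth_into_compose[OF assms(2) _ _ assms(1)])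
  show "smooth_fun_on D' (\<lambda>q. q + t)"
    by (intro smooth_fun_on_add assms smooth_fun_on_id smooth_fun_on_const)
qed (use assms(3) in auto)

text \<open>Where both are defined, \<open>t \<mapsto> a (s + t)\<close> and \<open>a\<close> have the same constant logarithmic derivative, hence
  differ by the left factor \<open>a s\<close>.\<close>

lemma local_one_param:
  "\<exists>d>0. \<exists>a. smooth_into G {-d<..<d} a \<and> tangent a X \<and>
     (\<forall>s\<in>{-d<..<d}. \<forall>t\<in>{-d<..<d}. a (s + t) = a s \<otimes> a t)"
proof -
  obtain e a where e: "e > 0" and a: "smooth_into G {-e<..<e} a" "a 0 = \<one>"
    "\<And>t v. t \<in> {-e<..<e} \<Longrightarrow> darboux G a t v = v *\<^sub>R X"
    using local_integral_curve[of X] by blast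
  let ?d = "e / 2" and ?D = "{-(e/2)<..<e/2}"
  have D: "?D \<subseteq> {-e<..<e}" using e by auto
  have sm: "smooth_into G ?D a" by (rule smooth_into_subset[OF a(1) _ D]) simp
  have hom: "a (s + t) = a s \<otimes> a t" if s: "s \<in> ?D" and t: "t \<in> ?D" for s t
  proof -
    have sh: "q + s \<in> {-e<..<e}" if "q \<in> ?D" for q using that s by auto
    have sm': "smooth_into G ?D (\<lambda>q. a (q + s))" by (rule smooth_into_shift[OF a(1) _ sh]) simp
    have eq: "darboux G a q v = darboux G (\<lambda>q. a (q + s)) q v" if "q \<in> ?D" for q v
      unfolding darboux_shift using a(3)[OF sh[OF that]] a(3)[of q] D that by auto
    have "0 \<in> ?D" using e by auto
    from darboux_eq_imp_left_translate[OF _ _ sm sm' eq t this]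
    have "a (t + s) \<otimes> inv (a t) = a (0 + s) \<otimes> inv (a 0)" by simp
    moreover have c: "a t \<in> carrier G" "a (t + s) \<in> carrier G" "a s \<in> carrier G"
      using smooth_into_carrier[OF sm t] smooth_into_carrier[OF sm' t] smooth_into_carrier[OF sm s] .
    ultimately have "a (t + s) \<otimes> inv (a t) = a s" by (simp add: a(2))
    then have "a s \<otimes> a t = a (t + s) \<otimes> inv (a t) \<otimes> a t" by simp
    also have "\<dots> = a (t + s)" using c by (simp add: m_assoc)
    finally show ?thesis by (simp add: add.commute)
  qed
  have "tangent a X"
  proof -
    have 0: "0 \<in> {-e<..<e}" using e by simp
    have "tangent (\<lambda>s. inv (a 0) \<otimes> a (0 + s *\<^sub>R 1)) (darboux G a 0 1)"
      by (rule darboux_tangent[OF _ 0 a(1)]) simp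
    moreover have "darboux G a 0 1 = X" using a(3)[OF 0, of 1] by simp
    ultimately have t: "tangent (\<lambda>s. inv \<one> \<otimes> a s) X" by (simp add: a(2))
    show ?thesis
    proof (rule tangent_cong[OF t])
      show "eventually (\<lambda>s. inv \<one> \<otimes> a s = a s) (nhds 0)"
        unfolding eventually_nhds
        using 0 smooth_into_carrier[OF a(1)] by (intro exI[of _ "{-e<..<e}"]) simp
    qed
  qed
  with e sm hom show ?thesis by (intro exI[of _ ?d] conjI exI[of _ a]) simp_all
qed

lemma one_param_one:
  assumes "one_param_subgroup G \<gamma>" shows "\<gamma> 0 = \<one>"
proof -
  have "\<gamma> 0 \<in> carrier G" using assms smooth_into_carrier unfolding one_param_subgroup_def by blast
  moreover have "\<gamma> (0 + 0) = \<gamma> 0 \<otimes> \<gamma> 0" using assms unfolding one_param_subgroup_def by blast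
  ultimately show ?thesis using r_cancel_one[of "\<gamma> 0" "\<gamma> 0"] by simp
qed

lemma one_param_carrier: "one_param_subgroup G \<gamma> \<Longrightarrow> \<gamma> t \<in> carrier G"
  unfolding one_param_subgroup_def by (elim conjE) (rule smooth_into_carrier, assumption, simp)

lemma one_param_tangent: "one_param_subgroup G \<gamma> \<Longrightarrow> tangent \<gamma> (velocity G \<gamma>)"
  using smooth_tangent[of UNIV \<gamma>] one_param_one[of \<gamma>] by (simp add: one_param_subgroup_def)

text \<open>A local homomorphism \<open>a\<close> from the real line extends to a global one, whose value at \<open>t\<close> is
  \<open>(a (t / 2\<^sup>n))\<close> raised to the power \<open>2\<^sup>n\<close>; this does not depend on the large number \<open>n\<close>.\<close>

lemma one_param_exists: "\<exists>\<gamma>. one_param_subgroup G \<gamma> \<and> velocity G \<gamma> = X"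
proof -
  obtain d a where d: "d > 0" and a: "smooth_into G {-d<..<d} a" "tangent a X"
    and hom: "\<And>s t. \<bar>s\<bar> < d \<Longrightarrow> \<bar>t\<bar> < d \<Longrightarrow> a (s + t) = a s \<otimes> a t"
    using local_one_param[of X] by (auto simp: abs_less_iff)
  have ac: "a t \<in> carrier G" if "\<bar>t\<bar> < d" for t
    using smooth_into_carrier[OF a(1)] that by (auto simp: abs_less_iff)
  define b where "b n t = a (t / 2 ^ n) [^] ((2::nat) ^ n)" for n :: nat and t
  have small: "\<bar>t / 2 ^ n\<bar> < d \<longleftrightarrow> \<bar>t\<bar> < 2 ^ n * d" for t n
    by (simp add: field_simps)
  have step: "b (Suc n) t = b n t" if t: "\<bar>t\<bar> < 2 ^ n * d" for n t
  proof -
    let ?x = "t / 2 ^ Suc n"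
    have "\<bar>?x\<bar> < d" using t d unfolding small by simp
    moreover have "?x + ?x = t / 2 ^ n" by (simp add: field_simps)
    ultimately have "a (t / 2 ^ n) = a ?x \<otimes> a ?x" and c: "a ?x \<in> carrier G"
      using hom[of ?x ?x] ac by simp_all
    moreover have "a ?x [^] ((2::nat) ^ Suc n) = (a ?x [^] (2::nat)) [^] ((2::nat) ^ n)"
      using c by (simp add: nat_pow_pow)
    moreover have "a ?x [^] (2::nat) = a ?x \<otimes> a ?x"
      using c by (simp add: numeral_2_eq_2)
    ultimately show ?thesis by (simp add: b_def)
  qed
  have mono: "b (n + m) t = b n t" if t: "\<bar>t\<bar> < 2 ^ n * d" for n m t
  proof (induction m)
    case (Suc m)
    have "2 ^ n * d \<le> 2 ^ (n + m) * d" using d by simp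
    then have "b (Suc (n + m)) t = b (n + m) t" by (intro step) (use t in linarith)
    then show ?case using Suc by simp
  qed simp
  define N where "N t = (LEAST n. \<bar>t\<bar> < 2 ^ n * d)" for t :: real
  define \<gamma> where "\<gamma> t = b (N t) t" for t
  have ex: "\<exists>n. \<bar>t\<bar> < 2 ^ n * d" for t
  proof -
    obtain n where "\<bar>t\<bar> / d < 2 ^ n" using real_arch_pow[of 2 "\<bar>t\<bar> / d"] by auto
    then show ?thesis using d by (auto simp: field_simps)
  qed
  have g: "\<gamma> t = b n t" if t: "\<bar>t\<bar> < 2 ^ n * d" for t n
  proof -
    have "N t \<le> n" unfolding N_def using t by (rule Least_le)
    then obtain m where "n = N t + m" using le_Suc_ex by blast
    moreover have "\<bar>t\<bar> < 2 ^ N t * d" unfolding N_def using t by (rule LeastI)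
    ultimately show ?thesis unfolding \<gamma>_def using mono by simp
  qed
  have ga: "\<gamma> t = a t" if "\<bar>t\<bar> < d" for t
    using g[of t 0] ac[OF that] that by (simp add: b_def)
  have ghom: "\<gamma> (s + t) = \<gamma> s \<otimes> \<gamma> t" for s t
  proof -
    obtain n where n: "\<bar>s\<bar> + \<bar>t\<bar> < 2 ^ n * d" using ex[of "\<bar>s\<bar> + \<bar>t\<bar>"] by auto
    let ?x = "s / 2 ^ n" and ?y = "t / 2 ^ n"
    have st: "\<bar>s\<bar> < 2 ^ n * d" "\<bar>t\<bar> < 2 ^ n * d" "\<bar>s + t\<bar> < 2 ^ n * d" using n by linarith+
    have xy: "\<bar>?x\<bar> < d" "\<bar>?y\<bar> < d" using st(1,2) by (simp_all only: small)
    have "a (?x + ?y) = a ?x \<otimes> a ?y" "a (?y + ?x) = a ?y \<otimes> a ?x" using hom xy by simp_all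
    then have "a ?x \<otimes> a ?y = a ?y \<otimes> a ?x" by (simp add: add.commute)
    from pow_mult_distrib[OF this ac[OF xy(1)] ac[OF xy(2)]]
    have "a (?x + ?y) [^] ((2::nat) ^ n) = b n s \<otimes> b n t"
      using \<open>a (?x + ?y) = a ?x \<otimes> a ?y\<close> by (simp add: b_def)
    then show ?thesis using g[OF st(1)] g[OF st(2)] g[OF st(3)] by (simp add: b_def add_divide_distrib)
  qed
  have gc: "\<gamma> t \<in> carrier G" for t
  proof -
    obtain n where n: "\<bar>t\<bar> < 2 ^ n * d" using ex by blast
    then have "a (t / 2 ^ n) \<in> carrier G" using ac small by blast
    then show ?thesis unfolding g[OF n] b_def by (rule nat_pow_closed)
  qed
  have "smooth_into G UNIV \<gamma>"
  proof (rule smooth_into_local)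
    fix t :: real
    let ?B = "{t - d<..<t + d}"
    have "smooth_into G ?B (\<lambda>q. a (q + (-t)))" by (rule smooth_into_shift[OF a(1)]) auto
    then have "smooth_into G ?B (\<lambda>q. \<gamma> t \<otimes> a (q + (-t)))"
      by (intro smooth_into_mult smooth_into_const gc) simp_all
    then have "smooth_into G ?B \<gamma>"
    proof (rule smooth_into_cong)
      fix q assume "q \<in> ?B"
      then have "\<gamma> (q + (-t)) = a (q + (-t))" by (intro ga) auto
      then show "\<gamma> t \<otimes> a (q + (-t)) = \<gamma> q" using ghom[of t "q + (-t)"] by simp
    qed
    moreover have "t \<in> ?B" using d by simp
    ultimately show "\<exists>N. open N \<and> t \<in> N \<and> N \<subseteq> UNIV \<and> smooth_into G N \<gamma>"
      by (intro exI[of _ ?B]) simp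
  qed
  moreover have "tangent \<gamma> X"
  proof (rule tangent_cong[OF a(2)])
    show "eventually (\<lambda>s. a s = \<gamma> s) (nhds 0)"
      unfolding eventually_nhds using d ga by (intro exI[of _ "{-d<..<d}"]) (auto simp: abs_less_iff)
  qed
  ultimately show ?thesis
    using ghom tangent_velocity by (intro exI[of _ \<gamma>]) (simp add: one_param_subgroup_def)
qed

lemma one_param_rescale:
  assumes "one_param_subgroup G \<gamma>"
  shows "one_param_subgroup G (\<lambda>s. \<gamma> (s * r))"
    and "velocity G (\<lambda>s. \<gamma> (s * r)) = r *\<^sub>R velocity G \<gamma>"
proof -
  have sm: "smooth_into G UNIV \<gamma>" and hom: "\<And>s t. \<gamma> (s + t) = \<gamma> s \<otimes> \<gamma> t"
    using assms by (simp_all add: one_param_subgroup_def)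
  have "smooth_into G UNIV (\<lambda>s. \<gamma> (s * r))"
    by (rule smooth_into_compose[OF _ _ _ sm])
      (simp_all add: smooth_fun_on_bounded_linear_comp[OF bounded_linear_mult_left _ smooth_fun_on_id])
  then show op: "one_param_subgroup G (\<lambda>s. \<gamma> (s * r))"
    by (simp add: one_param_subgroup_def hom distrib_right)
  have c: "((\<lambda>s. co (\<gamma> s)) has_vector_derivative velocity G \<gamma>) (at 0)"
    using one_param_tangent[OF assms] by (simp add: tangent_def)
  have "((\<lambda>s. s * r) has_vector_derivative r) (at 0)" by (auto intro!: derivative_eq_intros)
  then have "((\<lambda>s. co (\<gamma> s)) \<circ> (\<lambda>s. s * r) has_vector_derivative r *\<^sub>R velocity G \<gamma>) (at 0)"
    by (rule vector_diff_chain_at) (simp add: c)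
  then have "((\<lambda>s. co (\<gamma> (s * r))) has_vector_derivative r *\<^sub>R velocity G \<gamma>) (at 0)"
    by (simp add: o_def)
  then show "velocity G (\<lambda>s. \<gamma> (s * r)) = r *\<^sub>R velocity G \<gamma>"
    using one_param_tangent[OF op] vector_derivative_unique_at unfolding tangent_def by blast
qed

lemma darboux_one_param:
  assumes "one_param_subgroup G \<gamma>"
  shows "darboux G \<gamma> t v = v *\<^sub>R velocity G \<gamma>"
proof -
  have "inv (\<gamma> t) \<otimes> \<gamma> (t + s *\<^sub>R v) = \<gamma> (s * v)" for s
  proof -
    have "\<gamma> (t + s *\<^sub>R v) = \<gamma> t \<otimes> \<gamma> (s * v)"
      using assms by (simp add: one_param_subgroup_def)
    then show ?thesis using one_param_carrier[OF assms] by (simp add: m_assoc[symmetric])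
  qed
  then show ?thesis unfolding darboux_def using one_param_rescale(2)[OF assms] by simp
qed

text \<open>The logarithmic derivative of a one-parameter subgroup is constant and equal to its velocity.\<close>

lemma one_param_unique:
  assumes \<gamma>: "one_param_subgroup G \<gamma>" and \<delta>: "one_param_subgroup G \<delta>"
    and "velocity G \<gamma> = velocity G \<delta>"
  shows "\<gamma> = \<delta>"
proof
  fix t
  have sm: "smooth_into G UNIV \<gamma>" "smooth_into G UNIV \<delta>"
    using \<gamma> \<delta> by (simp_all add: one_param_subgroup_def)
  have "\<delta> t \<otimes> inv (\<gamma> t) = \<delta> 0 \<otimes> inv (\<gamma> 0)"
    by (rule darboux_eq_imp_left_translate[OF open_UNIV connected_UNIV sm])
      (simp_all add: darboux_one_param \<gamma> \<delta> assms(3))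
  then have "\<delta> t \<otimes> inv (\<gamma> t) = \<one>" by (simp add: one_param_one \<gamma> \<delta>)
  then have "\<delta> t \<otimes> inv (\<gamma> t) \<otimes> \<gamma> t = \<one> \<otimes> \<gamma> t" by simp
  then show "\<gamma> t = \<delta> t"
    using one_param_carrier[OF \<gamma>, of t] one_param_carrier[OF \<delta>, of t] by (simp add: m_assoc)
qed

lemma one_param_eq_lie_exp:
  assumes "one_param_subgroup G \<gamma>"
  shows "\<gamma> t = lie_exp G (t *\<^sub>R velocity G \<gamma>)"
proof -
  let ?\<delta> = "\<lambda>s. \<gamma> (s * t)"
  note r = one_param_rescale[OF assms, of t]
  have "(THE \<delta>. one_param_subgroup G \<delta> \<and> velocity G \<delta> = t *\<^sub>R velocity G \<gamma>) = ?\<delta>"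
    by (rule the_equality) (use r one_param_unique in simp_all)
  then show ?thesis by (simp add: lie_exp_def)
qed

lemma lie_exp_one_param:
  shows "one_param_subgroup G (\<lambda>t. lie_exp G (t *\<^sub>R X))" and "velocity G (\<lambda>t. lie_exp G (t *\<^sub>R X)) = X"
proof -
  obtain \<gamma> where \<gamma>: "one_param_subgroup G \<gamma>" "velocity G \<gamma> = X" using one_param_exists by blast
  have "(\<lambda>t. lie_exp G (t *\<^sub>R X)) = \<gamma>"
    using one_param_eq_lie_exp[OF \<gamma>(1)] \<gamma>(2) by (simp add: fun_eq_iff)
  then show "one_param_subgroup G (\<lambda>t. lie_exp G (t *\<^sub>R X))" "velocity G (\<lambda>t. lie_exp G (t *\<^sub>R X)) = X"
    using \<gamma> by simp_all
qed

end

section \<open>The complexified Lie algebra\<close>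

lemma cscale_add_left: "cscale (a + b) Z = cscale a Z + cscale b Z"
  by (simp add: cscale_def algebra_simps prod_eq_iff)

lemma cscale_add_right: "cscale a (Z + W) = cscale a Z + cscale a W"
  by (simp add: cscale_def algebra_simps prod_eq_iff)

lemma cscale_mult: "cscale (a * b) Z = cscale a (cscale b Z)"
  by (simp add: cscale_def algebra_simps prod_eq_iff)

lemma cscale_zero_left: "cscale 0 Z = 0"
  by (simp add: cscale_def prod_eq_iff)

lemma cscale_zero_right: "cscale c 0 = 0"
  by (simp add: cscale_def prod_eq_iff)

lemma cscale_one: "cscale 1 Z = Z"
  by (simp add: cscale_def)

lemma cscale_sum_left: "cscale (\<Sum>i\<in>I. c i) Z = (\<Sum>i\<in>I. cscale (c i) Z)"
  by (induction I rule: infinite_finite_induct) (simp_all add: cscale_zero_left cscale_add_left)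

lemma cscale_sum_right: "cscale c (\<Sum>i\<in>I. Z i) = (\<Sum>i\<in>I. cscale c (Z i))"
  by (induction I rule: infinite_finite_induct) (simp_all add: cscale_zero_right cscale_add_right)

lemma cextend_cscale: "linear f \<Longrightarrow> cextend f (cscale c Z) = cscale c (cextend f Z)"
  by (simp add: cextend_def cscale_def linear_add linear_diff linear_cmul)

lemma cextend_add: "linear f \<Longrightarrow> cextend f (Z + W) = cextend f Z + cextend f W"
  by (simp add: cextend_def linear_add)

lemma cextend_diff: "linear f \<Longrightarrow> cextend f (Z - W) = cextend f Z - cextend f W"
  by (simp add: cextend_def linear_diff)

lemma cextend_scaleR: "linear f \<Longrightarrow> cextend f (r *\<^sub>R Z) = r *\<^sub>R cextend f Z"
  by (simp add: cextend_def linear_cmul)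

lemma cextend_sum:
  assumes "linear f" shows "cextend f (\<Sum>i\<in>I. Z i) = (\<Sum>i\<in>I. cextend f (Z i))"
  by (induction I rule: infinite_finite_induct)
    (simp_all add: cextend_add[OF assms], simp_all add: cextend_def linear_0[OF assms] zero_prod_def)

lemma cextend_cembed: "linear f \<Longrightarrow> cextend f (cembed X) = cembed (f X)"
  by (simp add: cextend_def cembed_def linear_0)

lemma cembed_sum: "cembed (\<Sum>i\<in>I. X i) = (\<Sum>i\<in>I. cembed (X i))"
  by (simp add: cembed_def prod_eq_iff fst_sum snd_sum)

lemma root_of_one_power: "k \<ge> 1 \<Longrightarrow> root_of_one k ^ k = 1"
  using complex_root_unity[of k 1] by (simp add: root_of_one_def)

lemma root_of_one_power_neq_one:
  assumes "0 < j" and "j < k"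
  shows "root_of_one k ^ j \<noteq> 1"
proof -
  have "root_of_one k ^ j = exp (2 * of_real pi * \<i> * of_nat j / of_nat k)"
    unfolding root_of_one_def by (simp add: exp_of_nat_mult[symmetric] mult_ac)
  then show ?thesis using complex_root_unity_eq_1[of k j] assms by (auto dest: dvd_imp_le)
qed

lemma sum_powers_root_of_unity: "(x::complex) ^ k = 1 \<Longrightarrow> x \<noteq> 1 \<Longrightarrow> (\<Sum>j<k. x ^ j) = 0"
  by (simp add: geometric_sum)

section \<open>The reductive decomposition of a \<open>k\<close>-symmetric space\<close>

locale k_sym = lie_grp G for G :: "('g, 'e::euclidean_space) lie_group_data" (structure) +
  fixes \<tau> :: "'g \<Rightarrow> 'g" and K :: "'g set" and k :: nat
  assumes ksym: "k_symmetric G \<tau> K k"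
begin

abbreviation "T \<equiv> diff_one G \<tau>"

lemma k_ge: "k \<ge> 2" and tau_smooth: "smooth_self_map G \<tau>" and subgroup_K: "subgroup K G"
  and tau_order: "g \<in> carrier G \<Longrightarrow> (\<tau> ^^ k) g = g"
  using ksym by (simp_all add: k_symmetric_def)

lemma tau_mult: "x \<in> carrier G \<Longrightarrow> y \<in> carrier G \<Longrightarrow> \<tau> (x \<otimes> y) = \<tau> x \<otimes> \<tau> y"
  using ksym by (auto simp: k_symmetric_def iso_def hom_def)

lemma K_fixed: "h \<in> K \<Longrightarrow> \<tau> h = h" and K_carrier: "h \<in> K \<Longrightarrow> h \<in> carrier G"
  using ksym by (auto simp: k_symmetric_def fixed_group_def)

lemma tau_one: "\<tau> \<one> = \<one>"
  by (rule K_fixed) (rule subgroup.one_closed[OF subgroup_K])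

lemmas T_linear = diff_one_linear_and_tangent(1)[OF tau_smooth tau_one]
lemmas T_tangent = diff_one_linear_and_tangent(2)[OF tau_smooth tau_one]

lemma T_power_linear: "linear (T ^^ j)"
proof (induction j)
  case (Suc j)
  then show ?case using linear_compose[OF Suc T_linear] by (simp add: o_def)
qed (simp add: module_hom_ident linear_id[unfolded id_def])

lemma T_order: "(T ^^ k) X = X"
proof -
  let ?a = "\<lambda>s. coi (e0 + s *\<^sub>R X)"
  have "tangent (\<lambda>s. (\<tau> ^^ j) (?a s)) ((T ^^ j) X)" for j
    by (induction j) (simp_all add: tangent_line T_tangent)
  then have "tangent ?a ((T ^^ k) X)"
  proof (rule tangent_cong)
    show "eventually (\<lambda>s. (\<tau> ^^ k) (?a s) = ?a s) (nhds 0)"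
      using tangent_carrier[OF tangent_line[of X]] by eventually_elim (rule tau_order)
  qed
  then show ?thesis by (rule tangent_unique[OF _ tangent_line])
qed

text \<open>A curve in \<open>K\<close> is fixed pointwise by \<open>\<tau>\<close>.\<close>

lemma tangent_in_K:
  assumes "tangent a X" and "eventually (\<lambda>s. a s \<in> K) (nhds 0)"
  shows "T X = X"
proof -
  have "tangent (\<lambda>s. \<tau> (a s)) (T X)" by (rule T_tangent[OF assms(1)])
  then have "tangent a (T X)"
    by (rule tangent_cong) (use assms(2) in \<open>eventually_elim, simp add: K_fixed\<close>)
  then show ?thesis by (rule tangent_unique[OF _ assms(1)])
qed

text \<open>If \<open>T X = X\<close>, then \<open>\<tau>\<close> maps the one-parameter subgroup of \<open>X\<close> to one with the same velocity, thus
  fixes it; being connected, it lies in the identity component of the fixed group and so in \<open>K\<close>.\<close>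

lemma k_alg_eq: "k_alg G K = {X. T X = X}"
proof (intro subset_antisym subsetI)
  fix X assume "X \<in> k_alg G K"
  then have K: "lie_exp G (t *\<^sub>R X) \<in> K" for t by (simp add: k_alg_def)
  have "tangent (\<lambda>t. lie_exp G (t *\<^sub>R X)) X"
    using one_param_tangent[OF lie_exp_one_param(1)] by (simp add: lie_exp_one_param(2))
  then have "T X = X" by (rule tangent_in_K) (simp add: K)
  then show "X \<in> {X. T X = X}" by simp
next
  fix X assume "X \<in> {X. T X = X}"
  then have TX: "T X = X" by simp
  let ?g = "\<lambda>t. lie_exp G (t *\<^sub>R X)"
  note op = lie_exp_one_param(1)[of X]
  have sm: "smooth_into G UNIV ?g" and hom: "\<And>s t. ?g (s + t) = ?g s \<otimes> ?g t"
    using op by (simp_all only: one_param_subgroup_def)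
  have gc: "?g t \<in> carrier G" for t by (rule one_param_carrier[OF op])
  have op': "one_param_subgroup G (\<lambda>t. \<tau> (?g t))"
    unfolding one_param_subgroup_def
  proof (intro conjI allI)
    show "smooth_into G UNIV (\<lambda>t. \<tau> (?g t))" by (rule smooth_into_self_map[OF open_UNIV sm tau_smooth])
    show "\<tau> (?g (s + t)) = \<tau> (?g s) \<otimes> \<tau> (?g t)" for s t
      by (simp only: hom tau_mult[OF gc gc])
  qed
  have "tangent (\<lambda>t. \<tau> (?g t)) (T X)"
    using T_tangent[OF one_param_tangent[OF op]] by (simp add: lie_exp_one_param(2))
  then have "velocity G (\<lambda>t. \<tau> (?g t)) = velocity G ?g"
    by (simp add: tangent_velocity TX lie_exp_one_param(2))
  from one_param_unique[OF op' op this] have fx: "\<tau> (?g t) = ?g t" for t by (rule fun_cong)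
  have "connectedin (topo G) (range ?g)"
    by (rule connectedin_continuous_map_image[OF smooth_into_continuous_map[OF sm]])
      simp
  then have "connectedin (subtopology (topo G) (fixed_group G \<tau>)) (range ?g)"
    unfolding connectedin_subtopology using fx gc by (auto simp: fixed_group_def)
  moreover have "\<one> \<in> range ?g"
    using one_param_one[OF op] by (rule range_eqI[OF sym])
  ultimately have "range ?g \<subseteq>
      connected_component_of_set (subtopology (topo G) (fixed_group G \<tau>)) \<one>"
    by (intro connected_component_of_maximal)
  then have "range ?g \<subseteq> K" using ksym by (auto simp: k_symmetric_def)
  then show "X \<in> k_alg G K" by (auto simp: k_alg_def)
qed

text \<open>Up to the factor \<open>k\<close>, the projection onto \<open>k_alg G K\<close> along \<open>m_space G \<tau> k\<close>.\<close>

definition orbit_sum :: "'e \<Rightarrow> 'e" where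
  "orbit_sum X = (\<Sum>j<k. (T ^^ j) X)"

lemma orbit_sum_linear: "linear orbit_sum"
  unfolding orbit_sum_def[abs_def] by (rule linear_compose_sum) (simp add: T_power_linear)

lemma T_orbit_sum: "T (orbit_sum X) = orbit_sum X"
proof -
  have "T (orbit_sum X) = (\<Sum>j<k. (T ^^ Suc j) X)" by (simp add: orbit_sum_def linear_sum[OF T_linear])
  moreover have "X + (\<Sum>j<k. (T ^^ Suc j) X) = orbit_sum X + X"
    using sum.lessThan_Suc_shift[of "\<lambda>j. (T ^^ j) X" k] by (simp add: orbit_sum_def T_order)
  ultimately show ?thesis by simp
qed

lemma orbit_sum_fixed:
  assumes "T X = X" shows "orbit_sum X = real k *\<^sub>R X"
proof -
  have "(T ^^ j) X = X" for j by (induction j) (simp_all add: assms)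
  then show ?thesis by (simp add: orbit_sum_def sum_constant_scaleR)
qed

text \<open>Summing over the powers of \<open>T\<close> kills the eigenspaces of the nontrivial roots of unity. Conversely,
  the discrete Fourier transform splits every vector into eigenvectors, and the component for the
  eigenvalue \<open>1\<close> is a multiple of \<open>orbit_sum X\<close>.\<close>

lemma m_space_eq: "m_space G \<tau> k = {X. orbit_sum X = 0}"
proof (intro subset_antisym subsetI)
  let ?w = "root_of_one k"
  have wk: "?w ^ k = 1" using k_ge by (intro root_of_one_power) simp
  have w0: "?w \<noteq> 0" by (simp add: root_of_one_def)
  {
    fix X assume "X \<in> m_space G \<tau> k"
    then obtain Z where Z: "\<And>l. l \<in> {1..<k} \<Longrightarrow> Z l \<in> eigenspace G \<tau> k (int l)"
      and X: "cembed X = (\<Sum>l\<in>{1..<k}. Z l)"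
      unfolding m_space_def by blast
    have PZ: "cextend orbit_sum (Z l) = 0" if l: "l \<in> {1..<k}" for l
    proof -
      have TZ: "cextend T (Z l) = cscale (?w ^ l) (Z l)"
        using Z[OF l] by (simp add: eigenspace_def)
      have TjZ: "cextend (T ^^ j) (Z l) = cscale ((?w ^ l) ^ j) (Z l)" for j
      proof (induction j)
        case 0
        then show ?case by (simp add: cextend_def cscale_one)
      next
        case (Suc j)
        have "cextend (T ^^ Suc j) (Z l) = cextend T (cextend (T ^^ j) (Z l))"
          by (simp add: cextend_def)
        also have "\<dots> = cscale ((?w ^ l) ^ j * ?w ^ l) (Z l)"
          by (simp add: Suc cextend_cscale[OF T_linear] TZ cscale_mult)
        finally show ?case by (simp add: mult.commute o_def)
      qed
      have "cextend orbit_sum (Z l) = (\<Sum>j<k. cextend (T ^^ j) (Z l))"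
        by (simp add: cextend_def orbit_sum_def prod_eq_iff fst_sum snd_sum)
      also have "\<dots> = cscale (\<Sum>j<k. (?w ^ l) ^ j) (Z l)"
        by (simp add: TjZ cscale_sum_left)
      also have "(\<Sum>j<k. (?w ^ l) ^ j) = 0"
      proof (rule sum_powers_root_of_unity)
        show "(?w ^ l) ^ k = 1" using wk by (metis power_commutes power_mult mult.commute power_one)
        show "?w ^ l \<noteq> 1" using l by (intro root_of_one_power_neq_one) simp_all
      qed
      finally show ?thesis by (simp add: cscale_zero_left)
    qed
    have "cembed (orbit_sum X) = cextend orbit_sum (cembed X)" by (simp add: cextend_cembed[OF orbit_sum_linear])
    also have "\<dots> = 0" unfolding X cextend_sum[OF orbit_sum_linear] by (simp add: PZ)
    finally show "X \<in> {X. orbit_sum X = 0}" by (simp add: cembed_def zero_prod_def)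
  next
    fix X assume "X \<in> {X. orbit_sum X = 0}"
    then have PX: "orbit_sum X = 0" by simp
    define v where "v = inverse ?w"
    have vk: "v ^ k = 1" by (simp add: v_def power_inverse wk)
    \<comment> \<open>the component of \<open>X\<close> in the eigenspace of \<open>?w ^ l\<close>, by the discrete Fourier transform\<close>
    define Z where "Z l = cscale (1 / of_nat k) (\<Sum>j<k. cscale ((v ^ l) ^ j) (cembed ((T ^^ j) X)))" for l
    have ZE: "Z l \<in> eigenspace G \<tau> k (int l)" for l
    proof -
      let ?f = "\<lambda>j. cscale ((v ^ l) ^ j) (cembed ((T ^^ j) X))"
      have f: "cextend T (?f j) = cscale (?w ^ l) (?f (Suc j))" for j
      proof -
        have "?w ^ l * v ^ l = 1" using w0 by (simp add: v_def power_mult_distrib[symmetric])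
        then have "?w ^ l * (v ^ l) ^ Suc j = (v ^ l) ^ j" by (simp add: mult.assoc[symmetric])
        then have "cscale (?w ^ l) (?f (Suc j)) = cscale ((v ^ l) ^ j) (cembed ((T ^^ Suc j) X))"
          by (simp only: cscale_mult[symmetric])
        then show ?thesis by (simp add: cextend_cscale[OF T_linear] cextend_cembed[OF T_linear])
      qed
      have "(v ^ l) ^ k = 1" using vk by (metis power_mult mult.commute power_one)
      then have "?f k = ?f 0" by (simp add: T_order)
      then have sh: "(\<Sum>j<k. ?f (Suc j)) = (\<Sum>j<k. ?f j)"
        using sum.lessThan_Suc_shift[of ?f k] by (simp add: add.commute)
      have "cextend T (\<Sum>j<k. ?f j) = cscale (?w ^ l) (\<Sum>j<k. ?f j)"
        by (simp only: cextend_sum[OF T_linear] f cscale_sum_right[symmetric] sh)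
      then have "cextend T (Z l) = cscale (1 / of_nat k) (cscale (?w ^ l) (\<Sum>j<k. ?f j))"
        unfolding Z_def cextend_cscale[OF T_linear] by simp
      also have "\<dots> = cscale (?w ^ l) (Z l)"
        unfolding Z_def by (simp only: cscale_mult[symmetric] mult.commute)
      finally show ?thesis by (simp add: eigenspace_def)
    qed
    have Z0: "Z 0 = 0"
      using PX by (simp add: Z_def cscale_one cembed_sum[symmetric] orbit_sum_def[symmetric])
        (simp add: cembed_def zero_prod_def[symmetric] cscale_zero_right)
    have "(\<Sum>l<k. Z l) = cscale (1 / of_nat k)
        (\<Sum>j<k. cscale (\<Sum>l<k. (v ^ j) ^ l) (cembed ((T ^^ j) X)))"
    proof -
      have "(\<Sum>l<k. Z l) = cscale (1 / of_nat k)
          (\<Sum>l<k. \<Sum>j<k. cscale ((v ^ l) ^ j) (cembed ((T ^^ j) X)))"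
        unfolding Z_def by (rule cscale_sum_right[symmetric])
      also have "(\<Sum>l<k. \<Sum>j<k. cscale ((v ^ l) ^ j) (cembed ((T ^^ j) X)))
          = (\<Sum>j<k. \<Sum>l<k. cscale ((v ^ l) ^ j) (cembed ((T ^^ j) X)))"
        by (rule sum.swap)
      finally show ?thesis
        by (simp add: cscale_sum_left power_mult[symmetric] mult.commute)
    qed
    also have "(\<Sum>j<k. cscale (\<Sum>l<k. (v ^ j) ^ l) (cembed ((T ^^ j) X)))
        = (\<Sum>j<k. if j = 0 then cscale (of_nat k) (cembed X) else 0)"
    proof (rule sum.cong[OF refl])
      fix j assume j: "j \<in> {..<k}"
      show "cscale (\<Sum>l<k. (v ^ j) ^ l) (cembed ((T ^^ j) X))
        = (if j = 0 then cscale (of_nat k) (cembed X) else 0)"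
      proof (cases "j = 0")
        case False
        have "(\<Sum>l<k. (v ^ j) ^ l) = 0"
        proof (rule sum_powers_root_of_unity)
          show "(v ^ j) ^ k = 1" using vk by (metis power_mult mult.commute power_one)
          have "?w ^ j \<noteq> 1" using False j by (intro root_of_one_power_neq_one) simp_all
          then show "v ^ j \<noteq> 1" by (simp add: v_def power_inverse)
        qed
        then show ?thesis using False by (simp add: cscale_zero_left)
      qed simp
    qed
    also have "\<dots> = cscale (of_nat k) (cembed X)"
      using k_ge by (simp add: sum.delta)
    also have "cscale (1 / of_nat k) (cscale (of_nat k) (cembed X)) = cembed X"
      using k_ge by (simp add: cscale_mult[symmetric] cscale_one)
    finally have "cembed X = (\<Sum>l<k. Z l)" by simp
    also have "{..<k} = insert 0 {1..<k}" using k_ge by auto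
    finally have "cembed X = (\<Sum>l\<in>{1..<k}. Z l)" by (simp add: Z0)
    with ZE show "X \<in> m_space G \<tau> k" unfolding m_space_def by blast
  }
qed

lemma k_part_eq: "k_part G \<tau> K k X = (1 / real k) *\<^sub>R orbit_sum X"
  and m_part_eq: "m_part G \<tau> K k X = X - (1 / real k) *\<^sub>R orbit_sum X"
proof -
  let ?Y = "(1 / real k) *\<^sub>R orbit_sum X"
  have k0: "real k \<noteq> 0" using k_ge by simp
  have TY: "T ?Y = ?Y" by (simp add: linear_cmul[OF T_linear] T_orbit_sum)
  have PXY: "orbit_sum (X - ?Y) = 0"
    using k0 by (simp add: linear_diff[OF orbit_sum_linear] orbit_sum_fixed[OF TY])
  have u: "Y = ?Y" if "T Y = Y" "orbit_sum (X - Y) = 0" for Y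
    using that k0 by (simp add: linear_diff[OF orbit_sum_linear] orbit_sum_fixed)
  show "k_part G \<tau> K k X = ?Y"
    unfolding k_part_def k_alg_eq m_space_eq
  proof (rule the_equality)
    show "?Y \<in> {X. T X = X} \<and> X - ?Y \<in> {X. orbit_sum X = 0}" using TY PXY by simp
    show "Y = ?Y" if "Y \<in> {X. T X = X} \<and> X - Y \<in> {X. orbit_sum X = 0}" for Y
      by (rule u) (use that in simp_all)
  qed
  show "m_part G \<tau> K k X = X - ?Y"
    unfolding m_part_def k_alg_eq m_space_eq
  proof (rule the_equality)
    show "X - ?Y \<in> {X. orbit_sum X = 0} \<and> X - (X - ?Y) \<in> {X. T X = X}" using TY PXY by simp
    fix Y assume "Y \<in> {X. orbit_sum X = 0} \<and> X - Y \<in> {X. T X = X}"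
    then have "X - Y = ?Y" by (intro u) simp_all
    then show "Y = X - ?Y" by (simp add: algebra_simps)
  qed
qed

text \<open>An element \<open>g\<close> of \<open>K\<close> is fixed by \<open>\<tau>\<close>, so conjugation by \<open>g\<close> commutes with \<open>\<tau>\<close>.\<close>

lemma Ad_T_commute:
  assumes "g \<in> K" shows "T (Ad G g X) = Ad G g (T X)"
proof -
  let ?a = "\<lambda>s. coi (e0 + s *\<^sub>R X)"
  have g: "g \<in> carrier G" and ig: "inv g \<in> K"
    using K_carrier[OF assms] subgroup.m_inv_closed[OF subgroup_K assms] .
  have "tangent (\<lambda>s. \<tau> (g \<otimes> ?a s \<otimes> inv g)) (T (Ad G g X))"
    by (intro T_tangent Ad_tangent_and_linear g tangent_line)
  then have "tangent (\<lambda>s. g \<otimes> \<tau> (?a s) \<otimes> inv g) (T (Ad G g X))"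
  proof (rule tangent_cong)
    show "eventually (\<lambda>s. \<tau> (g \<otimes> ?a s \<otimes> inv g) = g \<otimes> \<tau> (?a s) \<otimes> inv g) (nhds 0)"
      using tangent_carrier[OF tangent_line[of X]]
      by eventually_elim (simp add: tau_mult g K_fixed[OF assms] K_fixed[OF ig])
  qed
  moreover have "tangent (\<lambda>s. g \<otimes> \<tau> (?a s) \<otimes> inv g) (Ad G g (T X))"
    by (intro T_tangent Ad_tangent_and_linear g tangent_line)
  ultimately show ?thesis by (rule tangent_unique)
qed

lemma orbit_sum_Ad:
  assumes "g \<in> K" shows "orbit_sum (Ad G g X) = Ad G g (orbit_sum X)"
proof -
  have "(T ^^ j) (Ad G g X) = Ad G g ((T ^^ j) X)" for j
    by (induction j) (simp_all add: Ad_T_commute[OF assms])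
  then show ?thesis
    by (simp add: orbit_sum_def linear_sum[OF Ad_tangent_and_linear(1)[OF K_carrier[OF assms]]])
qed

section \<open>Gauge transformations of the associated family\<close>

lemma mc_form_eq_darboux: "mc_form G F p v = darboux G F p v"
  by (simp add: mc_form_def darboux_def)

lemma darboux_in_K:
  assumes h: "smooth_into G UNIV h" and K: "\<And>p. h p \<in> K"
  shows "T (darboux G h p v) = darboux G h p v"
proof (rule tangent_in_K[OF darboux_tangent[OF open_UNIV UNIV_I h]])
  show "eventually (\<lambda>s. inv (h p) \<otimes> h (p + s *\<^sub>R v) \<in> K) (nhds 0)"
    by (simp add: K subgroup.m_closed[OF subgroup_K] subgroup.m_inv_closed[OF subgroup_K])
qed

text \<open>A gauge transformation \<open>h\<close> with values in \<open>K\<close> acts on the whole family \<open>\<alpha>\<^sub>\<lambda>\<close> by one and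
  the same formula: \<open>Ad (h\<inverse>)\<close> preserves both summands of the reductive decomposition and commutes
  with the splitting into types, and \<open>h\<inverse> dh\<close> only enters the \<open>K\<close>-part.\<close>

lemma alpha_lambda_gauge:
  assumes F: "smooth_into G UNIV F" and h: "smooth_into G UNIV h" and K: "\<And>p. h p \<in> K"
  shows "alpha_lambda G \<tau> K k (\<lambda>p. F p \<otimes> h p) \<zeta> p v =
    cextend (Ad G (inv (h p))) (alpha_lambda G \<tau> K k F \<zeta> p v) + cembed (darboux G h p v)"
proof -
  let ?Q = "Ad G (inv (h p))" and ?F = "\<lambda>p. F p \<otimes> h p"
  have ihK: "inv (h p) \<in> K" by (rule subgroup.m_inv_closed[OF subgroup_K K])
  have Q: "linear ?Q" by (rule Ad_tangent_and_linear(1)[OF K_carrier[OF ihK]])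
  have mc: "mc_form G ?F p w = ?Q (mc_form G F p w) + darboux G h p w" for w
    unfolding mc_form_eq_darboux by (rule darboux_mult[OF open_UNIV UNIV_I F h])
  have Pmc: "orbit_sum (mc_form G ?F p w) = ?Q (orbit_sum (mc_form G F p w)) + real k *\<^sub>R darboux G h p w" for w
    by (simp add: mc linear_add[OF orbit_sum_linear] orbit_sum_Ad[OF ihK] orbit_sum_fixed[OF darboux_in_K[OF h K]])
  have k0: "real k \<noteq> 0" using k_ge by simp
  have ak: "alpha_k G \<tau> K k ?F p w = cextend ?Q (alpha_k G \<tau> K k F p w) + cembed (darboux G h p w)" for w
    using k0 by (simp add: alpha_k_def k_part_eq Pmc cextend_cembed[OF Q] linear_cmul[OF Q]
        scaleR_add_right) (simp add: cembed_def)
  have am: "alpha_m G \<tau> K k ?F p w = cextend ?Q (alpha_m G \<tau> K k F p w)" for w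
    using k0 by (simp add: alpha_m_def m_part_eq Pmc cextend_cembed[OF Q] linear_cmul[OF Q]
        linear_diff[OF Q] scaleR_add_right) (simp add: mc)
  show ?thesis
    by (simp add: alpha_lambda_def form_10_def form_01_def ak am cextend_add[OF Q]
        cextend_diff[OF Q] cextend_scaleR[OF Q] cextend_cscale[OF Q])
qed

end

section \<open>Equivariance of the associated family\<close>

context k_sym
begin

text \<open>The product rule and \<open>alpha_lambda_gauge\<close> transform both sides in the same way, and \<open>Ad (h\<inverse>)\<close> is
  injective. In particular \<open>\<alpha>\<^sub>\<lambda>\<close> of \<open>F\<close> is real because \<open>\<alpha>\<^sub>\<lambda>\<close> of \<open>F \<otimes> h\<close> is.\<close>

lemma darboux_gauged_frame:
  assumes F: "smooth_into G UNIV F" and h: "smooth_into G UNIV h" and K: "\<And>p. h p \<in> K"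
    and E: "smooth_into G UNIV E"
    and mc: "\<And>p v. cembed (mc_form G E p v) = alpha_lambda G \<tau> K k (\<lambda>p. F p \<otimes> h p) \<zeta> p v"
  shows "cembed (darboux G (\<lambda>p. E p \<otimes> inv (h p)) p v) = alpha_lambda G \<tau> K k F \<zeta> p v"
proof -
  let ?E = "\<lambda>p. E p \<otimes> inv (h p)" and ?Q = "Ad G (inv (h p))"
  let ?A = "alpha_lambda G \<tau> K k F \<zeta> p v"
  have hc: "h q \<in> carrier G" for q by (rule K_carrier[OF K])
  have E': "smooth_into G UNIV ?E" by (intro smooth_into_mult smooth_into_inv open_UNIV E h)
  have "?E q \<otimes> h q = E q" for q
    using smooth_into_carrier[OF E UNIV_I, of q] hc by (simp add: m_assoc)
  then have "darboux G E p v = ?Q (darboux G ?E p v) + darboux G h p v"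
    using darboux_mult[OF open_UNIV UNIV_I E' h, of p v] by simp
  then have "cembed (?Q (darboux G ?E p v)) + cembed (darboux G h p v)
      = cextend ?Q ?A + cembed (darboux G h p v)"
    using mc[of p v] unfolding alpha_lambda_gauge[OF F h K] mc_form_eq_darboux
    by (simp add: cembed_def)
  then have eq: "cembed (?Q (darboux G ?E p v)) = cextend ?Q ?A" by simp
  have Q0: "?Q 0 = 0" by (rule linear_0[OF Ad_tangent_and_linear(1)[OF inv_closed[OF hc]]])
  have "darboux G ?E p v = fst ?A"
    by (rule Ad_inj[OF inv_closed[OF hc[of p]]]) (use eq in \<open>simp add: cembed_def cextend_def\<close>)
  moreover have "0 = snd ?A"
    by (rule Ad_inj[OF inv_closed[OF hc[of p]]]) (use eq Q0 in \<open>simp add: cembed_def cextend_def\<close>)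
  ultimately show ?thesis by (simp add: cembed_def prod_eq_iff)
qed

text \<open>The translate of \<open>E\<close> by \<open>t\<close> has the same logarithmic derivative as \<open>E\<close>, hence equals \<open>c t \<otimes> E\<close>
  for a constant \<open>c t\<close>; translating by \<open>s\<close> and then by \<open>t\<close> shows that \<open>c\<close> is a homomorphism.\<close>

lemma invariant_darboux_imp_equivariant:
  assumes E: "smooth_into G UNIV E"
    and inv: "\<And>p v t. darboux G E (p + of_real t) v = darboux G E p (v::complex)"
  shows "\<exists>A. \<forall>t p. E (p + of_real t) = lie_exp G (t *\<^sub>R A) \<otimes> E p"
proof -
  define c where "c t = E (of_real t) \<otimes> inv (E 0)" for t
  have Ec: "E p \<in> carrier G" for p by (rule smooth_into_carrier[OF E UNIV_I])
  have cc: "c t \<in> carrier G" for t by (simp add: c_def Ec)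
  have shift: "E (p + of_real t) = c t \<otimes> E p" for t p
  proof -
    have E': "smooth_into G UNIV (\<lambda>q. E (q + of_real t))" by (rule smooth_into_shift[OF E]) simp_all
    have "E (p + of_real t) \<otimes> inv (E p) = E (0 + of_real t) \<otimes> inv (E 0)"
      by (rule darboux_eq_imp_left_translate[OF open_UNIV connected_UNIV E E' _ UNIV_I UNIV_I])
        (simp only: darboux_shift inv)
    then have "E (p + of_real t) \<otimes> inv (E p) \<otimes> E p = c t \<otimes> E p" by (simp add: c_def)
    then show ?thesis by (simp add: m_assoc Ec)
  qed
  have "smooth_into G UNIV (\<lambda>t. E (of_real t))"
    by (rule smooth_into_compose[OF open_UNIV _ _ E])
      (simp_all add: smooth_fun_on_bounded_linear_comp[OF bounded_linear_of_real open_UNIV smooth_fun_on_id])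
  then have "smooth_into G UNIV c"
    unfolding c_def by (intro smooth_into_mult smooth_into_const open_UNIV inv_closed Ec)
  moreover have "c (s + t) = c s \<otimes> c t" for s t
  proof -
    have "c (s + t) = E (of_real t + of_real s) \<otimes> inv (E 0)" by (simp add: c_def add.commute)
    also have "\<dots> = c s \<otimes> E (of_real t) \<otimes> inv (E 0)" by (simp only: shift)
    also have "\<dots> = c s \<otimes> c t" by (simp add: c_def m_assoc Ec)
    finally show ?thesis .
  qed
  ultimately have "one_param_subgroup G c" by (simp add: one_param_subgroup_def)
  from one_param_eq_lie_exp[OF this] shift show ?thesis by metis
qed

text \<open>At \<open>x = 0\<close> equivariance reads \<open>\<psi> y = F (0, y) K\<close>, so \<open>F\<close> itself supplies a global lift of \<open>\<psi>\<close>
  and \<open>exp (x A) F (0, y)\<close> frames the same map as \<open>F\<close>.\<close>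

lemma equivariant_frame:
  assumes F: "frame G K \<phi> F" and eqv: "R_equivariant G K \<phi>"
  shows "\<exists>A. \<forall>z. \<exists>h\<in>K. F z = lie_exp G (Re z *\<^sub>R A) \<otimes> F (Complex 0 (Im z)) \<otimes> h"
proof -
  obtain A \<psi> where \<psi>: "smooth_into_quotient G K \<psi>"
    and \<phi>: "\<And>x y. \<phi> (Complex x y) = lie_exp G (x *\<^sub>R A) <# \<psi> y"
    using eqv unfolding R_equivariant_def by blast
  have FK: "\<phi> z = F z <# K" and Fc: "F z \<in> carrier G" for z
    using F smooth_into_carrier[of UNIV F z] by (simp_all add: frame_def)
  have KG: "K \<subseteq> carrier G" by (rule subgroup.subset[OF subgroup_K])
  note op = lie_exp_one_param(1)[of A]
  have ec: "lie_exp G (t *\<^sub>R A) \<in> carrier G" for t by (rule one_param_carrier[OF op])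
  have e1: "lie_exp G (0 *\<^sub>R A) = \<one>" by (rule one_param_one[OF op])
  have "\<exists>h\<in>K. F z = lie_exp G (Re z *\<^sub>R A) \<otimes> F (Complex 0 (Im z)) \<otimes> h" for z
  proof -
    let ?y = "Im z" and ?e = "lie_exp G (Re z *\<^sub>R A)"
    obtain N g where g: "?y \<in> N" "smooth_into G N g" "\<forall>q\<in>N. \<psi> q = g q <# K"
      using spec[OF \<psi>[unfolded smooth_into_quotient_def], of ?y] by (elim exE conjE) (rule that)
    have "g ?y \<in> carrier G" by (rule smooth_into_carrier[OF g(2,1)])
    then have "\<psi> ?y \<subseteq> carrier G" using bspec[OF g(3,1)] l_coset_subset_G[OF KG] by simp
    then have "\<phi> (Complex 0 ?y) = \<psi> ?y" unfolding \<phi> e1 by (rule lcos_mult_one)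
    then have "F z <# K = ?e <# (F (Complex 0 ?y) <# K)"
      using \<phi>[of "Re z" ?y] by (simp add: FK)
    also have "\<dots> = (?e \<otimes> F (Complex 0 ?y)) <# K" by (rule lcos_m_assoc[OF KG ec Fc])
    finally have "F z <# K = (?e \<otimes> F (Complex 0 ?y)) <# K" .
    moreover have "F z \<otimes> \<one> \<in> F z <# K"
      unfolding l_coset_def using subgroup.one_closed[OF subgroup_K] by blast
    ultimately have "F z \<in> (?e \<otimes> F (Complex 0 ?y)) <# K" by (simp add: Fc)
    then show ?thesis unfolding l_coset_def by blast
  qed
  then show ?thesis by blast
qed

text \<open>Below, \<open>F'\<close> is the frame adapted to the translations and \<open>E'\<close> the correspondingly gauged \<open>E\<close>. On the
  line \<open>x = 0\<close> the cosets of \<open>E\<close> form the curve required by equivariance.\<close>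

lemma associated_map_equivariant:
  assumes F: "frame G K \<phi> F" and eqv: "R_equivariant G K \<phi>" and E: "smooth_into G UNIV E"
    and mc: "\<And>p v. cembed (mc_form G E p v) = alpha_lambda G \<tau> K k F \<zeta> p v"
  shows "R_equivariant G K (\<lambda>z. E z <# K)"
proof -
  obtain A h where hK: "\<And>z. h z \<in> K"
    and h: "\<And>z. F z = lie_exp G (Re z *\<^sub>R A) \<otimes> F (Complex 0 (Im z)) \<otimes> h z"
    using equivariant_frame[OF F eqv] by metis
  define F' where "F' z = lie_exp G (Re z *\<^sub>R A) \<otimes> F (Complex 0 (Im z))" for z
  have F_sm: "smooth_into G UNIV F" using F by (simp add: frame_def)
  have Fc: "F z \<in> carrier G" and Ec: "E z \<in> carrier G" and hc: "h z \<in> carrier G" for z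
    using smooth_into_carrier[OF F_sm] smooth_into_carrier[OF E] K_carrier[OF hK] by simp_all
  have KG: "K \<subseteq> carrier G" by (rule subgroup.subset[OF subgroup_K])
  note op = lie_exp_one_param(1)[of A]
  have ec: "lie_exp G (t *\<^sub>R A) \<in> carrier G" for t by (rule one_param_carrier[OF op])
  have lin: "bounded_linear (\<lambda>y. Complex 0 y)"
    unfolding Complex_eq of_real_0 add_0
    by (rule bounded_linear_compose[OF bounded_linear_mult_right bounded_linear_of_real])
  have F': "smooth_into G UNIV F'"
    unfolding F'_def
  proof (intro smooth_into_mult open_UNIV)
    have "smooth_into G UNIV (\<lambda>t. lie_exp G (t *\<^sub>R A))" using op by (simp only: one_param_subgroup_def)
    then show "smooth_into G UNIV (\<lambda>z. lie_exp G (Re z *\<^sub>R A))"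
      by (rule smooth_into_compose[OF open_UNIV _ _, rotated 2])
        (simp_all add: smooth_fun_on_bounded_linear_comp[OF bounded_linear_Re open_UNIV smooth_fun_on_id])
    show "smooth_into G UNIV (\<lambda>z. F (Complex 0 (Im z)))"
      by (rule smooth_into_compose[OF open_UNIV _ _ F_sm])
        (simp_all add: smooth_fun_on_bounded_linear_comp[OF lin open_UNIV
          smooth_fun_on_bounded_linear_comp[OF bounded_linear_Im open_UNIV smooth_fun_on_id]])
  qed
  have F'c: "F' z \<in> carrier G" for z by (simp add: F'_def ec Fc)
  have FF': "F = (\<lambda>z. F' z \<otimes> h z)" unfolding F'_def by (rule ext) (rule h)
  have "h z = inv (F' z) \<otimes> F z" for z
    using F'c hc by (subst FF') (simp add: m_assoc[symmetric])
  then have h_sm: "smooth_into G UNIV h"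
    by (intro smooth_into_cong[OF smooth_into_mult[OF open_UNIV smooth_into_inv[OF open_UNIV F'] F_sm]])
      simp
  define E' where "E' z = E z \<otimes> inv (h z)" for z
  have E': "smooth_into G UNIV E'"
    unfolding E'_def by (intro smooth_into_mult smooth_into_inv open_UNIV E h_sm)
  have dE': "cembed (darboux G E' p v) = alpha_lambda G \<tau> K k F' \<zeta> p v" for p v
    unfolding E'_def
    by (rule darboux_gauged_frame[OF F' h_sm hK E]) (simp only: mc FF'[symmetric])
  have "F' (p + of_real t) = lie_exp G (t *\<^sub>R A) \<otimes> F' p" for p t
  proof -
    have "lie_exp G ((t + Re p) *\<^sub>R A) = lie_exp G (t *\<^sub>R A) \<otimes> lie_exp G (Re p *\<^sub>R A)"
      using op unfolding one_param_subgroup_def by blast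
    then show ?thesis by (simp add: F'_def add.commute m_assoc ec Fc)
  qed
  then have "mc_form G F' (p + of_real t) v = mc_form G F' p v" for p t v
    unfolding mc_form_eq_darboux
    using darboux_shift[of F' "of_real t" p v]
      darboux_left_translate[OF open_UNIV UNIV_I F' ec, of t p v] by simp
  then have "alpha_lambda G \<tau> K k F' \<zeta> (p + of_real t) v = alpha_lambda G \<tau> K k F' \<zeta> p v" for p t v
    by (simp add: alpha_lambda_def alpha_k_def alpha_m_def form_10_def form_01_def)
  then have "cembed (darboux G E' (p + of_real t) v) = cembed (darboux G E' p v)" for p t v
    by (simp only: dE')
  then have "darboux G E' (p + of_real t) v = darboux G E' p v" for p t v
    by (simp add: cembed_def)
  from invariant_darboux_imp_equivariant[OF E' this]
  obtain B where B: "\<And>t p. E' (p + of_real t) = lie_exp G (t *\<^sub>R B) \<otimes> E' p" by blast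
  have eB: "lie_exp G (t *\<^sub>R B) \<in> carrier G" for t by (rule one_param_carrier[OF lie_exp_one_param(1)])
  have coset: "E' z <# K = E z <# K" for z
  proof -
    have ihK: "inv (h z) \<in> K" by (rule subgroup.m_inv_closed[OF subgroup_K hK])
    have "E' z <# K = E z <# (inv (h z) <# K)"
      unfolding E'_def by (rule lcos_m_assoc[OF KG Ec inv_closed[OF hc], symmetric])
    also have "inv (h z) <# K = K" by (rule coset_join3[OF inv_closed[OF hc] subgroup_K ihK])
    finally show ?thesis .
  qed
  let ?\<psi> = "\<lambda>y. E (Complex 0 y) <# K"
  have "smooth_into G UNIV (\<lambda>y. E (Complex 0 y))"
    by (rule smooth_into_compose[OF open_UNIV _ _ E])
      (simp_all add: smooth_fun_on_bounded_linear_comp[OF lin open_UNIV smooth_fun_on_id])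
  then have "smooth_into_quotient G K ?\<psi>"
    unfolding smooth_into_quotient_def
    by (intro allI exI[of _ UNIV] exI[of _ "\<lambda>y. E (Complex 0 y)"]) simp
  moreover have "E (Complex x y) <# K = lie_exp G (x *\<^sub>R B) <# ?\<psi> y" for x y
  proof -
    have "Complex x y = Complex 0 y + of_real x" by (simp add: complex_eq_iff)
    then have "E' (Complex x y) = lie_exp G (x *\<^sub>R B) \<otimes> E' (Complex 0 y)" by (simp only: B)
    then have "E (Complex x y) <# K = (lie_exp G (x *\<^sub>R B) \<otimes> E' (Complex 0 y)) <# K"
      by (simp only: coset[symmetric])
    also have "\<dots> = lie_exp G (x *\<^sub>R B) <# (E' (Complex 0 y) <# K)"
      by (rule lcos_m_assoc[OF KG eB smooth_into_carrier[OF E' UNIV_I], symmetric])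
    finally show ?thesis by (simp only: coset)
  qed
  ultimately show ?thesis unfolding R_equivariant_def by blast
qed

end

theorem proposition2p3:
  fixes G :: "('g, 'e::euclidean_space) lie_group_data"
    and \<tau> :: "'g \<Rightarrow> 'g" and K :: "'g set" and k :: nat
    and \<phi> :: "complex \<Rightarrow> 'g set"
    and F :: "complex \<Rightarrow> 'g"
    and E :: "complex \<Rightarrow> complex \<Rightarrow> 'g"
  assumes "compact_semisimple_lie_group G"
    and "k_symmetric G \<tau> K k"
    and "primitive_harmonic G \<tau> K k \<phi>"
    and "frame G K \<phi> F"
    and "extended_frame G \<tau> K k F E"
    and "R_equivariant G K \<phi>"
  shows "\<forall>\<zeta>. cmod \<zeta> = 1 \<longrightarrow> R_equivariant G K (\<lambda>z. E \<zeta> z <#\<^bsub>G\<^esub> K)"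
proof (intro allI impI)
  fix \<zeta> :: complex assume "cmod \<zeta> = 1"
  with assms(5) have E: "smooth_into G UNIV (E \<zeta>)"
    "\<And>p v. cembed (mc_form G (E \<zeta>) p v) = alpha_lambda G \<tau> K k F \<zeta> p v"
    by (simp_all add: extended_frame_def)
  have lie: "lie_group G" using assms(1) by (simp add: compact_semisimple_lie_group_def)
  then have "group G" by (simp add: lie_group_def)
  then interpret k_sym G \<tau> K k
    by (intro k_sym.intro lie_grp.intro lie_grp_axioms.intro k_sym_axioms.intro lie assms(2))
  show "R_equivariant G K (\<lambda>z. E \<zeta> z <#\<^bsub>G\<^esub> K)"
    by (rule associated_map_equivariant[OF assms(4,6) E])
qed

end
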